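(* Let $1\le m\le n$ be integers and let $G=K_{m,n}$ be the complete bipartite graph. For all integers $t$ with $2\le t\le\lambda(K_{m,n})+1$, the path-free complex $\mathrm{PF}_t(G)$ has the homotopy type of a wedge of spheres.
   Context: $\lambda(G)$ denotes the length (number of edges) of a longest path in $G$, so $\lambda(G)+1$ is the number of vertices in a longest path of $G$. $P_t$ is the path on $t$ vertices. $\mathrm{PF}_t(G)$ is the simplicial complex on $V(G)$ whose faces are the subsets $F\subseteq V(G)$ such that the induced subgraph $G[F]$ contains no subgraph (not necessarily induced) isomorphic to $P_t$. Homotopy type refers to the geometric realization. *)

theory Defs
  imports "HOL-Analysis.Analysis" "Graph_Theory.Graph_Theory"
begin

section \<open>Path-free complexes\<close>

text \<open>Undirected graphs are symmetric digraphs: an edge is a pair of opposite arcs.\<close>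

definition path_graph :: "nat \<Rightarrow> (nat, nat \<times> nat) pre_digraph" where
  "path_graph t =
     \<lparr> verts = {..<t},
       arcs = {(i, j). i < t \<and> j < t \<and> (j = Suc i \<or> i = Suc j)},
       tail = fst, head = snd \<rparr>"

definition longest_path_length :: "('a, 'b) pre_digraph \<Rightarrow> nat" where
  "longest_path_length G = Max (vwalk_length ` {p. vpath p G})"

definition path_free_complex :: "nat \<Rightarrow> ('a, 'b) pre_digraph \<Rightarrow> 'a set set" where
  "path_free_complex t G =
     {F. F \<subseteq> verts G \<and>
         \<not> (\<exists>H. subgraph H (G \<restriction> F) \<and> digraph_iso H (path_graph t))}"


section \<open>Geometric realization\<close>

text \<open>Points are given by barycentric coordinates. The topology is that of pointwise convergence,
  which is the usual one for complexes with finitely many vertices (for infinite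
  complexes it is in general coarser than the weak topology).\<close>

definition geometric_realization :: "'a set set \<Rightarrow> ('a \<Rightarrow> real) topology" where
  "geometric_realization K =
     subtopology (powertop_real UNIV)
       {x. (\<forall>v. 0 \<le> x v) \<and> {v. x v \<noteq> 0} \<in> K \<and> (\<Sum>v | x v \<noteq> 0. x v) = 1}"


section \<open>Wedges of spheres\<close>

definition quotient_topology :: "'a topology \<Rightarrow> ('a \<times> 'a) set \<Rightarrow> 'a set topology" where
  "quotient_topology X r = topology (\<lambda>U. U \<subseteq> topspace X // r \<and> openin X (\<Union>U))"

lemma openin_quotient_topology:
  assumes "equiv (topspace X) r"
  shows "openin (quotient_topology X r) U \<longleftrightarrow> U \<subseteq> topspace X // r \<and> openin X (\<Union>U)"
proof -
  have inter: "\<Union>(S \<inter> T) = \<Union>S \<inter> \<Union>T" if "S \<subseteq> topspace X // r" "T \<subseteq> topspace X // r" for S T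
    using quotient_disj[OF assms] that by blast
  have "istopology (\<lambda>U. U \<subseteq> topspace X // r \<and> openin X (\<Union>U))"
    unfolding istopology_def
  proof (intro conjI allI impI; (elim conjE)?)
    fix S T assume "S \<subseteq> topspace X // r" "T \<subseteq> topspace X // r" "openin X (\<Union>S)" "openin X (\<Union>T)"
    then show "openin X (\<Union>(S \<inter> T))" by (simp add: inter openin_Int)
  next
    fix \<K> :: "'a set set set"
    assume *: "\<forall>K\<in>\<K>. K \<subseteq> topspace X // r \<and> openin X (\<Union>K)"
    have "\<Union>(\<Union>\<K>) = (\<Union>K\<in>\<K>. \<Union>K)" by blast
    with * show "openin X (\<Union>(\<Union>\<K>))" by auto
  qed blast+
  then show ?thesis
    by (simp add: quotient_topology_def topology_inverse')
qed

lemma topspace_quotient_topology: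
  assumes "equiv (topspace X) r"
  shows "topspace (quotient_topology X r) = topspace X // r"
proof
  show "topspace (quotient_topology X r) \<subseteq> topspace X // r"
    using openin_quotient_topology[OF assms] openin_topspace by blast
  have "openin (quotient_topology X r) (topspace X // r)"
    by (simp add: openin_quotient_topology[OF assms] Union_quotient[OF assms])
  then show "topspace X // r \<subseteq> topspace (quotient_topology X r)"
    by (rule openin_subset)
qed

lemma quotient_map_quotient_topology:
  assumes r: "equiv (topspace X) r"
  shows "quotient_map X (quotient_topology X r) (\<lambda>x. r `` {x})"
  unfolding quotient_map_def topspace_quotient_topology[OF r]
proof (intro conjI allI impI)
  show "(\<lambda>x. r `` {x}) ` topspace X = topspace X // r"
    by (auto simp: quotient_def)
next
  fix U assume U: "U \<subseteq> topspace X // r"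
  have "{x \<in> topspace X. r `` {x} \<in> U} = \<Union>U"
  proof
    show "{x \<in> topspace X. r `` {x} \<in> U} \<subseteq> \<Union>U"
      using equiv_class_self[OF r] by blast
    show "\<Union>U \<subseteq> {x \<in> topspace X. r `` {x} \<in> U}"
    proof
      fix x assume "x \<in> \<Union>U"
      then obtain C where C: "C \<in> U" "x \<in> C" by blast
      then obtain y where y: "C = r `` {y}" "y \<in> topspace X"
        using U by (meson quotientE subsetD)
      then have "(y, x) \<in> r" using C by blast
      then have "C = r `` {x}" "x \<in> topspace X"
        using y equiv_class_eq[OF r] equiv_class_eq_iff[OF r] by blast+
      with C show "x \<in> {x \<in> topspace X. r `` {x} \<in> U}" by blast
    qed
  qed
  then show "openin X {x \<in> topspace X. r `` {x} \<in> U} \<longleftrightarrow> openin (quotient_topology X r) U"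
    using U by (simp add: openin_quotient_topology[OF r])
qed

definition wedge_rel ::
    "('i \<Rightarrow> 'a topology) \<Rightarrow> ('i \<Rightarrow> 'a) \<Rightarrow> 'i set \<Rightarrow> (('i \<times> 'a) \<times> ('i \<times> 'a)) set" where
  "wedge_rel X p I =
     Id_on (topspace (sum_topology X I)) \<union> {((i, p i), (j, p j)) | i j. i \<in> I \<and> j \<in> I}"

lemma equiv_wedge_rel:
  assumes "\<And>i. i \<in> I \<Longrightarrow> p i \<in> topspace (X i)"
  shows "equiv (topspace (sum_topology X I)) (wedge_rel X p I)"
  using assms unfolding wedge_rel_def
  by (intro equivI refl_onI symI transI) auto

definition wedge_topology ::
    "('i \<Rightarrow> 'a topology) \<Rightarrow> ('i \<Rightarrow> 'a) \<Rightarrow> 'i set \<Rightarrow> ('i \<times> 'a) set topology" where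
  "wedge_topology X p I = quotient_topology (sum_topology X I) (wedge_rel X p I)"

definition nsphere_basepoint :: "nat \<Rightarrow> real" where
  "nsphere_basepoint = (\<lambda>k. if k = 0 then 1 else 0)"

text \<open>The wedge of the spheres \<open>nsphere (d i)\<close> for \<open>i \<in> I\<close>, where the dimensions \<open>d i\<close> may differ.\<close>

definition sphere_wedge :: "(nat \<Rightarrow> nat) \<Rightarrow> nat set \<Rightarrow> (nat \<times> (nat \<Rightarrow> real)) set topology" where
  "sphere_wedge d I = wedge_topology (\<lambda>i. nsphere (d i)) (\<lambda>_. nsphere_basepoint) I"

text \<open>A wedge of spheres has at least one and only finitely many summands; in particular, a
  point does not count as an empty wedge. Spheres of dimension 0 are allowed.\<close>

definition homotopy_wedge_of_spheres :: "'a topology \<Rightarrow> bool" where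
  "homotopy_wedge_of_spheres X \<longleftrightarrow>
     (\<exists>I d. finite I \<and> I \<noteq> {} \<and> X homotopy_equivalent_space sphere_wedge d I)"

end

theory Submission
  imports Defs
begin

text \<open>
  Let \<open>U\<close>, \<open>V\<close> be the sides of the complete bipartite graph and write \<open>t = 2 * k + e\<close> with \<open>e \<le> 1\<close>. A path
  alternates between the sides, so a vertex set with \<open>a\<close> vertices in \<open>U\<close> and \<open>b\<close> vertices in \<open>V\<close> contains
  a path on \<open>t\<close> vertices iff \<open>k + e \<le> a\<close> and \<open>k \<le> b\<close>, or \<open>k \<le> a\<close> and \<open>k + e \<le> b\<close>. Thus the complex consists of
  the sets with \<open>a < k\<close>, or \<open>b < k\<close>, or both \<open>a < k + e\<close> and \<open>b < k + e\<close>
  (\<open>path_free_complex_bipartite\<close>), and the bound on \<open>t\<close> says that \<open>k \<le> m\<close> and \<open>k + e \<le> n\<close>.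

  The homotopy type of this complex is read off from an acyclic matching in the sense of discrete
  Morse theory. Toggling a vertex \<open>v \<in> V\<close> matches the simplices of the star of \<open>v\<close>; the simplices
  outside are then matched by toggling a vertex \<open>u \<in> U\<close>. The simplices matched by \<open>u\<close> can be
  collapsed away (\<open>collapse_by_toggling\<close>), and each unmatched simplex has its whole boundary
  in the star of \<open>v\<close>, which is a cone. A cone with some simplices glued in along their
  boundaries is a wedge of spheres (\<open>wedge_of_spheres_if_star_and_facets\<close>), one for each
  simplex, and the bounds on \<open>k\<close> guarantee that there is at least one.

  The last step is carried out by an explicit deformation in barycentric coordinates
  (\<open>push\<close>) together with a general criterion for being homotopy equivalent to a wedge
  (\<open>homotopy_equivalent_wedge\<close>).
\<close>

section \<open>Simplicial complexes and collapses\<close>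

abbreviation supp :: "('a \<Rightarrow> real) \<Rightarrow> 'a set" where
  "supp x \<equiv> {v. x v \<noteq> 0}"

definition simplicial_complex :: "'a set set \<Rightarrow> bool" where
  "simplicial_complex K \<longleftrightarrow> (\<forall>F\<in>K. finite F \<and> (\<forall>G. G \<subseteq> F \<longrightarrow> G \<in> K))"

lemma simplicial_complexD:
  assumes "simplicial_complex K" "F \<in> K"
  shows "finite F" and "G \<subseteq> F \<Longrightarrow> G \<in> K"
  using assms by (auto simp: simplicial_complex_def)

lemma mem_realization:
  "x \<in> topspace (geometric_realization K) \<longleftrightarrow>
     (\<forall>v. 0 \<le> x v) \<and> supp x \<in> K \<and> (\<Sum>v\<in>supp x. x v) = 1"
  by (simp add: geometric_realization_def)

lemma sum_supp:
  assumes "finite A" "supp x \<subseteq> A"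
  shows "sum x (supp x) = sum x A"
  using assms by (intro sum.mono_neutral_left) auto

lemma mem_realizationI:
  assumes "finite A" "supp x \<subseteq> A" "supp x \<in> K" "\<And>v. 0 \<le> x v" "sum x A = 1"
  shows "x \<in> topspace (geometric_realization K)"
  using assms sum_supp[OF assms(1,2)] by (simp add: mem_realization)

lemma sum_realization:
  assumes "x \<in> topspace (geometric_realization K)" "finite A" "supp x \<subseteq> A"
  shows "sum x A = 1"
  using assms sum_supp[OF assms(2,3)] by (simp add: mem_realization)

lemma realization_subcomplex:
  assumes "L \<subseteq> K"
  shows "geometric_realization L =
    subtopology (geometric_realization K) (topspace (geometric_realization L))"
  unfolding geometric_realization_def subtopology_subtopology
  using assms by (intro arg_cong[where f = "subtopology _"]) auto

lemma continuous_map_coordinate [continuous_intros]: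
  "continuous_map (geometric_realization K) euclideanreal (\<lambda>x. x w)"
  unfolding geometric_realization_def
  by (intro continuous_map_from_subtopology continuous_map_product_projection) simp

lemma continuous_map_into_realization:
  assumes "\<And>w. continuous_map X euclideanreal (\<lambda>z. f z w)"
    and "\<And>z. z \<in> topspace X \<Longrightarrow> f z \<in> topspace (geometric_realization K)"
  shows "continuous_map X (geometric_realization K) f"
  using assms unfolding geometric_realization_def
  by (auto simp: continuous_map_in_subtopology continuous_map_componentwise_UNIV)

lemma continuous_map_Min [continuous_intros]:
  fixes f :: "'w \<Rightarrow> 'z \<Rightarrow> real"
  assumes "finite A" "A \<noteq> {}" "\<And>w. w \<in> A \<Longrightarrow> continuous_map X euclideanreal (f w)"
  shows "continuous_map X euclideanreal (\<lambda>z. MIN w\<in>A. f w z)"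
  using assms
proof (induction A rule: finite_ne_induct)
  case (insert w A)
  then have "(\<lambda>z. MIN w\<in>insert w A. f w z) = (\<lambda>z. min (f w z) (MIN w\<in>A. f w z))"
    by (auto simp: fun_eq_iff)
  with insert show ?case by (auto intro!: continuous_map_real_min)
qed simp

lemma Min_eq_0_iff_supp:
  fixes x :: "'a \<Rightarrow> real"
  assumes "finite F" "F \<noteq> {}" "\<And>w. 0 \<le> x w"
  shows "0 \<le> (MIN w\<in>F. x w)" and "(MIN w\<in>F. x w) = 0 \<longleftrightarrow> \<not> F \<subseteq> supp x"
proof -
  show nn: "0 \<le> (MIN w\<in>F. x w)" using assms by simp
  have "(MIN w\<in>F. x w) \<le> 0 \<longleftrightarrow> (\<exists>w\<in>F. x w \<le> 0)"
    using assms by (subst Min_le_iff) auto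
  also have "\<dots> \<longleftrightarrow> \<not> F \<subseteq> supp x"
    using assms(3) by (auto simp: order_antisym_conv)
  finally show "(MIN w\<in>F. x w) = 0 \<longleftrightarrow> \<not> F \<subseteq> supp x" using nn by auto
qed

text \<open>If a free face \<open>F\<close> lies only in \<open>insert u F\<close>, one pushes away from \<open>F\<close> towards \<open>u\<close>: subtract the
  smallest coordinate over \<open>F\<close> from every coordinate in \<open>F\<close> and give the lost mass to \<open>u\<close>. At points
  whose support does not contain \<open>F\<close> this minimum is 0, so a single formula covers the whole
  complex, and scaling it by time gives the deformation.\<close>
lemma elementary_collapse:
  assumes K: "simplicial_complex K" and u: "u \<notin> F" and ne: "F \<noteq> {}" and FK: "insert u F \<in> K"
    and free: "\<And>G. G \<in> K \<Longrightarrow> F \<subseteq> G \<Longrightarrow> G = F \<or> G = insert u F"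
  shows "geometric_realization K homotopy_equivalent_space
         geometric_realization (K - {F, insert u F})"
proof -
  let ?X = "geometric_realization K" and ?K' = "K - {F, insert u F}"
  let ?Y = "geometric_realization ?K'"
  let ?I = "top_of_set {0..1::real}"
  define \<mu> where "\<mu> x = (MIN w\<in>F. x w)" for x :: "'a \<Rightarrow> real"
  define r where "r s x w = x w - (if w \<in> F then s * \<mu> x else 0)
      + (if w = u then s * (card F * \<mu> x) else 0)" for s w and x :: "'a \<Rightarrow> real"
  have fin: "finite F" "finite (insert u F)"
    using simplicial_complexD(1)[OF K FK] by auto
  have \<mu>: "0 \<le> \<mu> x" "\<mu> x = 0 \<longleftrightarrow> \<not> F \<subseteq> supp x" if "x \<in> topspace ?X" for x
    using Min_eq_0_iff_supp[OF fin(1) ne] that by (auto simp: \<mu>_def mem_realization)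
  have \<mu>_le: "\<mu> x \<le> x w" if "w \<in> F" for x w
    using that fin by (simp add: \<mu>_def)
  have r_triv: "r s x = x" if "\<mu> x = 0" for s x
    using that by (auto simp: r_def)
  have r_in: "r s x \<in> topspace ?X" and r1_in: "r 1 x \<in> topspace ?Y"
    if x: "x \<in> topspace ?X" and s: "0 \<le> s" "s \<le> 1" for s x
  proof -
    have *: "r s x \<in> topspace ?X \<and> (s = 1 \<longrightarrow> r s x \<in> topspace ?Y)" if s: "0 \<le> s" "s \<le> 1" for s
    proof (cases "\<mu> x = 0")
      case True
      then have "\<not> F \<subseteq> supp x" using \<mu> x by blast
      then have "supp x \<noteq> F" "supp x \<noteq> insert u F" by blast+
      then show ?thesis using x True by (simp add: r_triv mem_realization)
    next
      case False
      then have "F \<subseteq> supp x" using \<mu> x by blast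
      then have sx: "supp x \<subseteq> insert u F"
        using free[of "supp x"] x by (auto simp: mem_realization)
      have sm: "s * \<mu> x \<le> x w" if "w \<in> F" for w
        using mult_left_le_one_le[of "\<mu> x" s] \<mu>(1)[OF x] s \<mu>_le[OF that, of x] by linarith
      have nn: "0 \<le> r s x w" for w
        using sm[of w] x u \<mu>(1)[OF x] s by (auto simp: r_def mem_realization)
      have sr: "supp (r s x) \<subseteq> insert u F"
        using sx by (auto simp: r_def)
      have "sum (r s x) (insert u F) = sum x (insert u F)"
      proof -
        have "sum (r s x) F = (\<Sum>w\<in>F. x w - s * \<mu> x)"
          using u by (intro sum.cong) (auto simp: r_def)
        then show ?thesis using u fin by (simp add: r_def sum_subtractf)
      qed
      then have sum1: "sum (r s x) (insert u F) = 1"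
        using sum_realization[OF x fin(2) sx] by simp
      have inK: "supp (r s x) \<in> K"
        using simplicial_complexD(2)[OF K FK sr] .

      \<comment> \<open>At time 1 a vertex of \<open>F\<close> where the minimum is attained leaves the support.\<close>
      have inK': "supp (r s x) \<in> ?K'" if "s = 1"
      proof -
        have "\<mu> x \<in> x ` F"
          using fin ne unfolding \<mu>_def by (intro Min_in) auto
        then obtain w where "w \<in> F" "\<mu> x = x w" by blast
        then have "w \<in> F" "w \<notin> supp (r s x)"
          using that u by (auto simp: r_def)
        then show ?thesis using inK by auto
      qed
      show ?thesis
        using mem_realizationI[OF fin(2) sr inK nn sum1]
          mem_realizationI[OF fin(2) sr inK' nn sum1] by simp
    qed
    show "r s x \<in> topspace ?X" using *[OF s] by simp
    show "r 1 x \<in> topspace ?Y" using *[of 1] by simp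
  qed
  have cont_\<mu>: "continuous_map ?X euclideanreal \<mu>"
    unfolding \<mu>_def by (intro continuous_intros fin ne)
  have cont: "continuous_map (prod_topology ?I ?X) euclideanreal (\<lambda>z. r (fst z) (snd z) w)" for w
  proof -
    have f: "continuous_map (prod_topology ?I ?X) euclideanreal fst"
      using continuous_map_fst continuous_map_into_fulltopology by blast
    have c: "continuous_map (prod_topology ?I ?X) euclideanreal (\<lambda>z. snd z w)" for w
      using continuous_map_compose[OF continuous_map_snd continuous_map_coordinate]
      by (simp add: o_def)
    have m: "continuous_map (prod_topology ?I ?X) euclideanreal (\<lambda>z. \<mu> (snd z))"
      using continuous_map_compose[OF continuous_map_snd cont_\<mu>] by (simp add: o_def)
    show ?thesis
      unfolding r_def
      by (cases "w \<in> F"; cases "w = u"; simp; intro continuous_intros f c m; simp)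
  qed
  have "homotopic_with (\<lambda>_. True) ?X ?X id (r 1)"
    unfolding homotopic_with_def
  proof (intro exI conjI)
    show "continuous_map (prod_topology ?I ?X) ?X (\<lambda>z. r (fst z) (snd z))"
      using cont r_in by (intro continuous_map_into_realization) auto
    show "\<forall>x. r (fst (0, x)) (snd (0, x)) = id x" by (auto simp: r_def)
  qed auto
  moreover have "continuous_map ?X ?Y (r 1)"
  proof (rule continuous_map_into_realization)
    fix w
    have "continuous_map ?X (prod_topology ?I ?X) (\<lambda>x. (1, x))"
      by (intro continuous_map_pairedI) auto
    from continuous_map_compose[OF this cont] show "continuous_map ?X euclideanreal (\<lambda>x. r 1 x w)"
      by (simp add: o_def)
  qed (use r1_in[of _ 1] in auto)
  moreover have "continuous_map ?Y ?X id"
    by (intro continuous_map_into_realization) (auto intro!: continuous_intros simp: mem_realization)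
  moreover have "homotopic_with (\<lambda>_. True) ?Y ?Y (r 1) id"
  proof (rule homotopic_with_equal)
    fix x assume "x \<in> topspace ?Y"
    then have x: "x \<in> topspace ?X" "supp x \<notin> {F, insert u F}"
      by (auto simp: mem_realization)
    then have "\<not> F \<subseteq> supp x"
      using free[of "supp x"] by (simp add: mem_realization) blast
    then have "\<mu> x = 0" using \<mu>[OF x(1)] by blast
    then show "r 1 x = id x" by (simp add: r_triv)
  next
    show "continuous_map ?Y ?Y (r 1)"
      using continuous_map_compose[OF calculation(3,2)] by simp
  qed auto
  ultimately show ?thesis
    unfolding homotopy_equivalent_space_def
    by (intro exI[of _ "r 1"] exI[of _ id]) (auto simp: homotopic_with_sym)
qed

text \<open>The simplices to be removed come in pairs \<open>F\<close>, \<open>insert u F\<close>. A largest \<open>F\<close> without \<open>u\<close> is free: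
  a simplex above it cannot lie in the subcomplex, and so its part without \<open>u\<close> is again one of the
  simplices to be removed. Removing the pairs in this order is a sequence of elementary collapses.\<close>
lemma collapse_by_toggling:
  assumes K: "simplicial_complex K" and K': "simplicial_complex K'" and sub: "K' \<subseteq> K"
    and fin: "finite K" and empty: "{} \<in> K'"
    and add: "\<And>F. F \<in> K - K' \<Longrightarrow> insert u F \<in> K"
    and del: "\<And>F. F \<in> K - K' \<Longrightarrow> F - {u} \<notin> K'"
  shows "geometric_realization K homotopy_equivalent_space geometric_realization K'"
  using assms
proof (induction "card (K - K')" arbitrary: K rule: less_induct)
  case less
  note K = less.prems(1) and add = less.prems(6) and del = less.prems(7)
  show ?case
  proof (cases "K \<subseteq> K'")
    case True
    then show ?thesis using less.prems(3) homotopy_equivalent_space_refl by auto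
  next
    case False
    define D where "D = {F \<in> K - K'. u \<notin> F}"
    have down: "F - {u} \<in> D" if "F \<in> K - K'" for F
      using that del[OF that] simplicial_complexD(2)[OF K, of F] by (auto simp: D_def)
    have finD: "finite D" using less.prems(4) by (simp add: D_def)
    have "D \<noteq> {}" using False down by blast
    then obtain F where F: "F \<in> D" and max: "\<And>G. G \<in> D \<Longrightarrow> F \<subseteq> G \<Longrightarrow> G = F"
      using finite_has_maximal[OF finD] by metis
    have FK: "F \<in> K" "F \<notin> K'" "u \<notin> F" "insert u F \<in> K" "insert u F \<notin> K'"
      using F add[of F] simplicial_complexD(2)[OF K'(1), of "insert u F" F] by (auto simp: D_def)
    have free: "G = F \<or> G = insert u F" if G: "G \<in> K" "F \<subseteq> G" for G
    proof -
      have "G \<notin> K'" using simplicial_complexD(2)[OF K'] FK G by blast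
      then have "G - {u} = F" using down[of G] max[of "G - {u}"] G FK by blast
      then show ?thesis by blast
    qed
    let ?L = "K - {F, insert u F}"
    have "geometric_realization K homotopy_equivalent_space geometric_realization ?L"
      using FK less.prems(5) by (intro elementary_collapse K free) auto
    also have "\<dots> homotopy_equivalent_space geometric_realization K'"
    proof (rule less.hyps)
      show "card (?L - K') < card (K - K')"
        using FK less.prems(4) by (intro psubset_card_mono) auto
      show "simplicial_complex ?L"
        unfolding simplicial_complex_def
      proof (intro ballI conjI allI impI)
        fix G H assume "G \<in> ?L" "H \<subseteq> G"
        then show "H \<in> ?L"
          using simplicial_complexD(2)[OF K, of G H] free[of G] by auto
      qed (use simplicial_complexD(1)[OF K] in auto)
      show "insert u G \<in> ?L" if G: "G \<in> ?L - K'" for G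
        using add[of G] FK G by auto
      show "G - {u} \<notin> K'" if G: "G \<in> ?L - K'" for G
        using del[of G] G by auto
    qed (use less.prems FK in auto)
    finally show ?thesis .
  qed
qed

section \<open>Spaces that are homotopy equivalent to a wedge\<close>

lemma continuous_map_sum_projection:
  assumes "i \<in> I"
  shows "continuous_map (subtopology (sum_topology X I) ({i} \<times> topspace (X i))) (X i) snd"
proof -
  have "openin (subtopology (sum_topology X I) ({i} \<times> topspace (X i)))
      {z \<in> topspace (subtopology (sum_topology X I) ({i} \<times> topspace (X i))). snd z \<in> U}"
    if U: "openin (X i) U" for U
  proof -
    have "openin (sum_topology X I) ({i} \<times> U)"
    proof -
      have "{i} \<times> U = Pair i ` U" by auto
      then show ?thesis
        using open_map_component_injection[OF assms, of X] U by (simp add: open_map_def)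
    qed
    moreover have "{z \<in> topspace (subtopology (sum_topology X I) ({i} \<times> topspace (X i))). snd z \<in> U}
        = ({i} \<times> U) \<inter> ({i} \<times> topspace (X i))"
      using assms openin_subset[OF U] by auto
    ultimately show ?thesis by (simp add: openin_subtopology_Int)
  qed
  then show ?thesis by (auto simp: continuous_map_def)
qed

lemma continuous_map_from_sum:
  assumes "\<And>i. i \<in> I \<Longrightarrow> continuous_map (X i) Y (f i)"
  shows "continuous_map (sum_topology X I) Y (\<lambda>(i, x). f i x)"
  unfolding continuous_map_def
proof (intro conjI allI impI)
  show "(\<lambda>(i, x). f i x) \<in> topspace (sum_topology X I) \<rightarrow> topspace Y"
    using assms by (fastforce simp: continuous_map_def)
next
  fix U assume U: "openin Y U"
  have "openin (X i) {x \<in> topspace (X i). f i x \<in> U}" if "i \<in> I" for i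
    using assms[OF that] U by (auto simp: continuous_map_def)
  then show "openin (sum_topology X I) {z \<in> topspace (sum_topology X I). (\<lambda>(i, x). f i x) z \<in> U}"
    by (auto simp: openin_sum_topology)
qed

lemma wedge_class_eq_iff:
  assumes "\<And>i. i \<in> I \<Longrightarrow> p i \<in> topspace (X i)"
    and "i \<in> I" "x \<in> topspace (X i)" "j \<in> I" "y \<in> topspace (X j)"
  shows "wedge_rel X p I `` {(i, x)} = wedge_rel X p I `` {(j, y)} \<longleftrightarrow>
    i = j \<and> x = y \<or> x = p i \<and> y = p j"
proof -
  have "wedge_rel X p I `` {(i, x)} = wedge_rel X p I `` {(j, y)} \<longleftrightarrow>
      ((i, x), (j, y)) \<in> wedge_rel X p I"
    using eq_equiv_class_iff[OF equiv_wedge_rel[where I = I and X = X and p = p, OF assms(1)]] assms by auto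
  also have "\<dots> \<longleftrightarrow> i = j \<and> x = y \<or> x = p i \<and> y = p j"
    using assms by (auto simp: wedge_rel_def)
  finally show ?thesis .
qed

text \<open>A recognition principle for wedges. A finite closed cover of \<open>Z\<close> carries deformations that agree
  on overlaps, and the deformation of the \<open>i\<close>-th piece ends in a map factoring through \<open>X i\<close>, where
  overlaps go to the base point. The maps \<open>f i\<close> then paste to a map from \<open>Z\<close> to the wedge, the maps
  \<open>g i\<close> descend to the quotient, the deformations paste to a homotopy on \<open>Z\<close>, and the pointed
  homotopies on the summands descend to the wedge.\<close>
lemma homotopy_equivalent_wedge:
  fixes X :: "'i \<Rightarrow> 'a topology" and Z :: "'z topology"
  assumes fin: "finite I"
    and p: "\<And>i. i \<in> I \<Longrightarrow> p i \<in> topspace (X i)"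
    and clo: "\<And>i. i \<in> I \<Longrightarrow> closedin Z (C i)"
    and cover: "topspace Z \<subseteq> (\<Union>i\<in>I. C i)"
    and g: "\<And>i. i \<in> I \<Longrightarrow> continuous_map (X i) (subtopology Z (C i)) (g i)"
    and gp: "\<And>i. i \<in> I \<Longrightarrow> g i (p i) = base"
    and f: "\<And>i. i \<in> I \<Longrightarrow> continuous_map (subtopology Z (C i)) (X i) (f i)"
    and H: "\<And>i. i \<in> I \<Longrightarrow> continuous_map
      (prod_topology (top_of_set {0..1}) (subtopology Z (C i))) Z (\<lambda>(t, x). H i t x)"
    and H0: "\<And>i x. i \<in> I \<Longrightarrow> x \<in> C i \<Longrightarrow> H i 0 x = x"
    and H1: "\<And>i x. i \<in> I \<Longrightarrow> x \<in> C i \<Longrightarrow> H i 1 x = g i (f i x)"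
    and Heq: "\<And>i j x t. i \<in> I \<Longrightarrow> j \<in> I \<Longrightarrow> i \<noteq> j \<Longrightarrow> x \<in> C i \<Longrightarrow> x \<in> C j \<Longrightarrow>
      t \<in> {0..1::real} \<Longrightarrow> H i t x = H j t x"
    and fp: "\<And>i j x. i \<in> I \<Longrightarrow> j \<in> I \<Longrightarrow> i \<noteq> j \<Longrightarrow> x \<in> C i \<Longrightarrow> x \<in> C j \<Longrightarrow> f i x = p i"
    and hom: "\<And>i. i \<in> I \<Longrightarrow> homotopic_with (\<lambda>h. h (p i) = p i) (X i) (X i) (f i \<circ> g i) id"
  shows "Z homotopy_equivalent_space wedge_topology X p I"
proof -
  let ?J = "top_of_set {0..1::real}"
  let ?S = "sum_topology X I" and ?W = "wedge_topology X p I"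
  define q where "q z = wedge_rel X p I `` {z}" for z
  have q: "quotient_map ?S ?W q"
    unfolding q_def wedge_topology_def
    by (intro quotient_map_quotient_topology equiv_wedge_rel p)
  have qc: "continuous_map ?S ?W q" by (rule quotient_imp_continuous_map[OF q])
  have q_eq: "q (i, x) = q (j, y) \<longleftrightarrow> i = j \<and> x = y \<or> x = p i \<and> y = p j"
    if "i \<in> I" "x \<in> topspace (X i)" "j \<in> I" "y \<in> topspace (X j)" for i x j y
    unfolding q_def using wedge_class_eq_iff[OF p that] .
  have q_inj: "continuous_map (X i) ?W (\<lambda>x. q (i, x))" if "i \<in> I" for i
    using continuous_map_compose[OF continuous_map_component_injection[OF that] qc]
    by (simp add: o_def)
  have f_in: "f i x \<in> topspace (X i)" if "i \<in> I" "x \<in> C i" for i x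
    using continuous_map_funspace[OF f[OF that(1)]] closedin_subset[OF clo[OF that(1)]] that
    by (auto simp: Pi_iff)
  have g_in: "g i y \<in> C i" if "i \<in> I" "y \<in> topspace (X i)" for i y
    using continuous_map_funspace[OF g[OF that(1)]] that by (auto simp: Pi_iff)

  have "continuous_map ?S Z (\<lambda>(i, x). g i x)"
    using g by (intro continuous_map_from_sum) (auto simp: continuous_map_in_subtopology)
  then obtain G where G: "continuous_map ?W Z G"
    and Gq: "\<And>i y. i \<in> I \<Longrightarrow> y \<in> topspace (X i) \<Longrightarrow> G (q (i, y)) = g i y"
  proof (rule quotient_map_lift_exists[OF q])
    show "(\<lambda>(i, x). g i x) z = (\<lambda>(i, x). g i x) z'"
      if "z \<in> topspace ?S" "z' \<in> topspace ?S" "q z = q z'" for z z'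
      using that gp q_eq by (cases z; cases z') auto
  qed force

  define c where "c x = (SOME i. i \<in> I \<and> x \<in> C i)" for x
  have c: "c x \<in> I \<and> x \<in> C (c x)" if "x \<in> topspace Z" for x
  proof -
    have "\<exists>i. i \<in> I \<and> x \<in> C i" using cover that by blast
    then show ?thesis unfolding c_def by (rule someI_ex)
  qed
  define F where "F x = q (c x, f (c x) x)" for x
  have qf_eq: "q (i, f i x) = q (j, f j x)"
    if "i \<in> I" "j \<in> I" "x \<in> C i" "x \<in> C j" for i j x
    using that q_eq[of i "f i x" j "f j x"] f_in fp[of i j x] fp[of j i x] by auto
  have F_eq: "F x = q (i, f i x)" if "i \<in> I" "x \<in> C i" for i x
    unfolding F_def using that c[of x] closedin_subset[OF clo[OF that(1)]] by (intro qf_eq) auto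
  have F: "continuous_map Z ?W F"
  proof (rule pasting_lemma_closed[OF fin clo])
    show "continuous_map (subtopology Z (C i)) ?W (\<lambda>x. q (i, f i x))" if "i \<in> I" for i
      using continuous_map_compose[OF f[OF that] q_inj[OF that]] by (simp add: o_def)
    show "q (i, f i x) = q (j, f j x)"
      if "i \<in> I" "j \<in> I" "x \<in> topspace Z \<inter> C i \<inter> C j" for i j x
      using that qf_eq by blast
    show "\<exists>j. j \<in> I \<and> x \<in> C j \<and> F x = q (j, f j x)" if "x \<in> topspace Z" for x
      using c[OF that] by (auto simp: F_def)
  qed

  have "homotopic_with (\<lambda>_. True) Z Z id (G \<circ> F)"
  proof (subst homotopic_with, simp, intro exI conjI)
    show "continuous_map (prod_topology ?J Z) Z (\<lambda>(t, x). H (c x) t x)"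
    proof (rule pasting_lemma_closed[OF fin])
      show "closedin (prod_topology ?J Z) ({0..1} \<times> C i)" if "i \<in> I" for i
        using clo[OF that] closedin_topspace[of ?J] by (simp add: closedin_prod_Times_iff)
      show "continuous_map (subtopology (prod_topology ?J Z) ({0..1} \<times> C i)) Z (\<lambda>(t, x). H i t x)"
        if "i \<in> I" for i
        using H[OF that] by (simp add: prod_topology_subtopology)
      show "(\<lambda>(t, x). H i t x) z = (\<lambda>(t, x). H j t x) z"
        if "i \<in> I" "j \<in> I" "z \<in> topspace (prod_topology ?J Z) \<inter> ({0..1} \<times> C i) \<inter> ({0..1} \<times> C j)"
        for i j z
        using that Heq[of i j] by (cases "i = j") auto
      show "\<exists>j. j \<in> I \<and> z \<in> {0..1} \<times> C j \<and> (\<lambda>(t, x). H (c x) t x) z = (\<lambda>(t, x). H j t x) z"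
        if "z \<in> topspace (prod_topology ?J Z)" for z
        using that c by auto
    qed
    show "\<forall>x\<in>topspace Z. (\<lambda>(t, x). H (c x) t x) (0, x) = id x"
      using c H0 by auto
    show "\<forall>x\<in>topspace Z. (\<lambda>(t, x). H (c x) t x) (1, x) = (G \<circ> F) x"
      using c H1 f_in Gq by (auto simp: F_def)
  qed auto
  moreover have "homotopic_with (\<lambda>_. True) ?W ?W (F \<circ> G) id"
  proof -
    have "\<forall>i\<in>I. \<exists>k. continuous_map (prod_topology ?J (X i)) (X i) k \<and>
        (\<forall>y. k (0, y) = f i (g i y)) \<and> (\<forall>y. k (1, y) = y) \<and> (\<forall>t\<in>{0..1}. k (t, p i) = p i)"
      using hom by (auto simp: homotopic_with_def)
    then obtain k where kc: "\<And>i. i \<in> I \<Longrightarrow> continuous_map (prod_topology ?J (X i)) (X i) (k i)"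
      and k0: "\<And>i y. i \<in> I \<Longrightarrow> k i (0, y) = f i (g i y)"
      and k1: "\<And>i y. i \<in> I \<Longrightarrow> k i (1, y) = y"
      and kp: "\<And>i t. i \<in> I \<Longrightarrow> t \<in> {0..1} \<Longrightarrow> k i (t, p i) = p i"
      by (metis (lifting) bchoice)
    have k_in: "k i (t, y) \<in> topspace (X i)" if "i \<in> I" "t \<in> {0..1}" "y \<in> topspace (X i)" for i t y
      using continuous_map_funspace[OF kc[OF that(1)]] that by (auto simp: Pi_iff)
    let ?k = "\<lambda>(t, i, y). q (i, k i (t, y))"
    have kq: "continuous_map (prod_topology ?J ?S) ?W ?k"
    proof (rule pasting_lemma_closed[OF fin])
      show "closedin (prod_topology ?J ?S) ({0..1} \<times> ({i} \<times> topspace (X i)))" if "i \<in> I" for i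
      proof -
        have "closedin ?S ({i} \<times> topspace (X i))"
        proof -
          have "{i} \<times> topspace (X i) = Pair i ` topspace (X i)" by auto
          then show ?thesis
            using closed_map_component_injection[OF that, of X] by (simp add: closed_map_def)
        qed
        then show ?thesis
          using closedin_topspace[of ?J] by (simp add: closedin_prod_Times_iff)
      qed
      show "continuous_map (subtopology (prod_topology ?J ?S) ({0..1} \<times> ({i} \<times> topspace (X i)))) ?W
          (\<lambda>(t, j, y). q (i, k i (t, y)))" if "i \<in> I" for i
      proof -
        let ?P = "prod_topology ?J (subtopology ?S ({i} \<times> topspace (X i)))"
        have "continuous_map ?P (prod_topology ?J (X i)) (\<lambda>z. (fst z, (snd \<circ> snd) z))"
          by (intro continuous_map_pairedI continuous_map_fst
              continuous_map_compose[OF continuous_map_snd continuous_map_sum_projection[OF that]])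
        from continuous_map_compose[OF continuous_map_compose[OF this kc[OF that]] q_inj[OF that]]
        have "continuous_map ?P ?W (\<lambda>(t, j, y). q (i, k i (t, y)))"
          by (simp add: o_def case_prod_unfold)
        then show ?thesis by (simp add: prod_topology_subtopology)
      qed
      show "(\<lambda>(t, j, y). q (i, k i (t, y))) z = (\<lambda>(t, j, y). q (i', k i' (t, y))) z"
        if "i \<in> I" "i' \<in> I" "z \<in> topspace (prod_topology ?J ?S) \<inter> ({0..1} \<times> ({i} \<times> topspace (X i))) \<inter>
           ({0..1} \<times> ({i'} \<times> topspace (X i')))" for i i' z
        using that by auto
      show "\<exists>j. j \<in> I \<and> z \<in> {0..1} \<times> ({j} \<times> topspace (X j)) \<and>
          ?k z = (\<lambda>(t, j', y). q (j, k j (t, y))) z"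
        if "z \<in> topspace (prod_topology ?J ?S)" for z
        using that by auto
    qed

    \<comment> \<open>The unit interval is locally compact Hausdorff, so its product with a quotient map is again
      a quotient map.\<close>
    have "quotient_map (prod_topology ?J ?S) (prod_topology ?J ?W) (\<lambda>(t, z). (t, q z))"
      by (intro quotient_map_prod_right q)
        (auto intro!: compact_imp_locally_compact_space Hausdorff_space_subtopology
          simp: compact_space_subtopology)
    then obtain k' where k': "continuous_map (prod_topology ?J ?W) ?W k'"
      and k'q: "\<And>t i y. t \<in> {0..1} \<Longrightarrow> i \<in> I \<Longrightarrow> y \<in> topspace (X i) \<Longrightarrow>
        k' (t, q (i, y)) = q (i, k i (t, y))"
    proof (rule quotient_map_lift_exists[OF _ kq])
      fix z z' assume z: "z \<in> topspace (prod_topology ?J ?S)" "z' \<in> topspace (prod_topology ?J ?S)"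
        "(\<lambda>(t, z). (t, q z)) z = (\<lambda>(t, z). (t, q z)) z'"
      obtain t i y where 1: "z = (t, i, y)" "t \<in> {0..1}" "i \<in> I" "y \<in> topspace (X i)"
        using z(1) by auto
      obtain t' j y' where 2: "z' = (t', j, y')" "t' \<in> {0..1}" "j \<in> I" "y' \<in> topspace (X j)"
        using z(2) by auto
      show "?k z = ?k z'"
        using z(3) 1 2 q_eq[of i y j y'] q_eq[of i "k i (t, y)" j "k j (t', y')"] k_in kp by auto
    qed force
    have W: "\<exists>i y. i \<in> I \<and> y \<in> topspace (X i) \<and> w = q (i, y)" if "w \<in> topspace ?W" for w
      
    proof -
      have "w \<in> q ` topspace ?S" using that quotient_imp_surjective_map[OF q] by simp
      then obtain i y where "i \<in> I" "y \<in> topspace (X i)" "w = q (i, y)" by auto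
      then show ?thesis by blast
    qed
    show ?thesis
    proof (subst homotopic_with, simp, intro exI conjI ballI)
      show "k' (0, w) = (F \<circ> G) w" if "w \<in> topspace ?W" for w
      proof -
        obtain i y where *: "i \<in> I" "y \<in> topspace (X i)" "w = q (i, y)" using W[OF \<open>w \<in> topspace ?W\<close>] by blast
        then show ?thesis
          by (simp add: k'q k0 Gq F_eq[OF _ g_in])
      qed
      show "k' (1, w) = id w" if "w \<in> topspace ?W" for w
      proof -
        obtain i y where *: "i \<in> I" "y \<in> topspace (X i)" "w = q (i, y)" using W[OF \<open>w \<in> topspace ?W\<close>] by blast
        then show ?thesis by (simp add: k'q k1)
      qed
    qed (use k' in auto)
  qed
  ultimately show ?thesis
    unfolding homotopy_equivalent_space_def
    using F G homotopic_with_sym by blast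
qed

section \<open>Pushing a simplex onto a sphere\<close>

text \<open>A deformation that inflates the interior of the simplex \<open>\<sigma>\<close> and drags everything else to \<open>v\<close>. Write a point
  of \<open>\<sigma>\<close> as \<open>\<mu>\<close> times the barycenter plus \<open>1 - \<mu>\<close> times a boundary point \<open>p\<close>. At time \<open>t\<close>, the points with
  \<open>\<mu> \<ge> t/2\<close> are stretched radially over all of \<open>\<sigma>\<close>, and those with \<open>\<mu> \<le> t/2\<close> go to the point
  \<open>(1 - c) p + c v\<close> of the cone over the boundary, where \<open>c = t - 2 \<mu>\<close>. Since \<open>(1 - \<mu>) p\<close> has the coordinates
  \<open>x w - m\<close> with \<open>m\<close> the smallest coordinate, both cases fit into one continuous formula. It also makes
  sense where \<open>m = 0\<close>: there it is the straight line to \<open>v\<close>, whatever \<open>\<sigma>\<close> is.\<close>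
definition push :: "'a set \<Rightarrow> 'a \<Rightarrow> real \<Rightarrow> ('a \<Rightarrow> real) \<Rightarrow> 'a \<Rightarrow> real" where
  "push \<sigma> v t x w =
    (let m = (MIN u\<in>\<sigma>. x u); \<mu> = real (card \<sigma>) * m; c = max 0 (t - 2 * \<mu>) in
      (if w \<in> \<sigma> then max 0 (\<mu> - t/2) / ((1 - t/2) * real (card \<sigma>)) else 0)
      + (1 - c) * (x w - (if w \<in> \<sigma> then m else 0)) / (1 - min \<mu> (t/2))
      + (if w = v then c else 0))"

abbreviation vertex_point :: "'a \<Rightarrow> 'a \<Rightarrow> real" where
  "vertex_point v \<equiv> (\<lambda>w. if w = v then 1 else 0)"

definition simplex_boundary :: "'a set \<Rightarrow> 'a set set" where
  "simplex_boundary A = {F. F \<subset> A}"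

lemma simplicial_complex_simplex_boundary:
  "finite A \<Longrightarrow> simplicial_complex (simplex_boundary A)"
  by (auto simp: simplicial_complex_def simplex_boundary_def dest: finite_subset)

lemma push_min_0:
  assumes "(MIN u\<in>\<sigma>. x u) = 0" "0 \<le> t"
  shows "push \<sigma> v t x = (\<lambda>w. (1 - t) * x w + (if w = v then t else 0))"
  using assms by (auto simp: push_def fun_eq_iff)

lemma push_time_0:
  assumes "finite \<sigma>" "\<sigma> \<noteq> {}" "0 \<le> (MIN u\<in>\<sigma>. x u)"
  shows "push \<sigma> v 0 x = x"
proof -
  have "0 \<le> real (card \<sigma>) * (MIN u\<in>\<sigma>. x u)" "card \<sigma> \<noteq> 0" using assms by auto
  then have "push \<sigma> v 0 x w = x w" for w
    by (simp add: push_def Let_def max_absorb1 max_absorb2 min_absorb2)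
  then show ?thesis by blast
qed

text \<open>Coordinate form of the two cases in the definition: the pushed point lies in \<open>\<sigma>\<close>, or in the cone
  from \<open>v\<close> over a proper face of \<open>\<sigma>\<close>, because a vertex with minimal coordinate gets coordinate 0 as soon
  as \<open>v\<close> gets a positive one.\<close>
lemma push_interior:
  assumes fin: "finite \<sigma>" and ne: "\<sigma> \<noteq> {}" and v: "v \<notin> \<sigma>"
    and x: "\<And>w. 0 \<le> x w" "supp x = \<sigma>" "sum x \<sigma> = 1" and t: "0 \<le> t" "t \<le> 1"
  defines "y \<equiv> push \<sigma> v t x"
  shows "\<And>w. 0 \<le> y w" and "sum y (insert v \<sigma>) = 1"
    and "supp y \<subseteq> \<sigma> \<or> (\<exists>w\<in>\<sigma>. supp y \<subseteq> insert v (\<sigma> - {w}))"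
proof -
  define m where "m = (MIN u\<in>\<sigma>. x u)"
  define \<mu> where "\<mu> = real (card \<sigma>) * m"
  define c where "c = max 0 (t - 2 * \<mu>)"
  have card: "0 < card \<sigma>" using fin ne by (simp add: card_gt_0_iff)
  have m_le: "m \<le> x w" if "w \<in> \<sigma>" for w using that fin by (simp add: m_def)
  have "0 \<le> m" unfolding m_def using Min_eq_0_iff_supp(1)[OF fin ne] x(1) by blast
  then have \<mu>0: "0 \<le> \<mu>" by (simp add: \<mu>_def)
  have "\<mu> \<le> sum x \<sigma>" unfolding \<mu>_def using sum_bounded_below[of \<sigma> m x] m_le by simp
  then have \<mu>1: "\<mu> \<le> 1" using x by simp
  have c: "0 \<le> c" "c \<le> 1" using \<mu>0 t by (auto simp: c_def)
  have xv: "x v = 0" using v x(2) by blast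
  have den: "0 < 1 - min \<mu> (t/2)" "0 < 1 - t/2" using t by auto
  have y_in: "y w = max 0 (\<mu> - t/2) / ((1 - t/2) * real (card \<sigma>)) + (1 - c) * (x w - m) / (1 - min \<mu> (t/2))"
    if "w \<in> \<sigma>" for w
    using that v by (auto simp: y_def push_def Let_def m_def \<mu>_def c_def)
  have y_out: "y w = (if w = v then c else 0)" if "w \<notin> \<sigma>" for w
  proof -
    have "x w = 0" using that x(2) by blast
    then show ?thesis using that by (simp add: y_def push_def Let_def m_def \<mu>_def c_def)
  qed
  show "0 \<le> y w" for w
  proof (cases "w \<in> \<sigma>")
    case True
    then show ?thesis unfolding y_in[OF True]
      using den c m_le[OF True] card by (intro add_nonneg_nonneg divide_nonneg_pos mult_nonneg_nonneg) auto
  qed (use y_out c in auto)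
  have sum\<sigma>: "sum y \<sigma> = max 0 (\<mu> - t/2) / (1 - t/2) + (1 - c) * (1 - \<mu>) / (1 - min \<mu> (t/2))"
  proof -
    have "sum y \<sigma> = (\<Sum>w\<in>\<sigma>. max 0 (\<mu> - t/2) / ((1 - t/2) * real (card \<sigma>)))
        + (\<Sum>w\<in>\<sigma>. (1 - c) * (x w - m) / (1 - min \<mu> (t/2)))"
      by (simp add: y_in sum.distrib)
    also have "(\<Sum>w\<in>\<sigma>. max 0 (\<mu> - t/2) / ((1 - t/2) * real (card \<sigma>))) = max 0 (\<mu> - t/2) / (1 - t/2)"
      using card den by (simp add: field_simps)
    also have "(\<Sum>w\<in>\<sigma>. (1 - c) * (x w - m) / (1 - min \<mu> (t/2))) = (1 - c) * (1 - \<mu>) / (1 - min \<mu> (t/2))"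
      using x(3) by (simp add: sum_subtractf \<mu>_def flip: sum_divide_distrib sum_distrib_left)
    finally show ?thesis .
  qed
  have "sum y (insert v \<sigma>) = c + sum y \<sigma>" using fin v y_out[OF v] by simp
  also have "\<dots> = 1"
  proof (cases "t/2 \<le> \<mu>")
    case True
    then have "c = 0" "max 0 (\<mu> - t/2) = \<mu> - t/2" "min \<mu> (t/2) = t/2" by (auto simp: c_def)
    then show ?thesis using den unfolding sum\<sigma> by (simp add: add_divide_distrib[symmetric])
  next
    case False
    then have "max 0 (\<mu> - t/2) = 0" "min \<mu> (t/2) = \<mu>" by auto
    then show ?thesis using den unfolding sum\<sigma> by simp
  qed
  finally show "sum y (insert v \<sigma>) = 1" .
  show "supp y \<subseteq> \<sigma> \<or> (\<exists>w\<in>\<sigma>. supp y \<subseteq> insert v (\<sigma> - {w}))"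
  proof (cases "c = 0")
    case True
    then show ?thesis using y_out by (auto split: if_splits)
  next
    case False
    then have \<mu>t: "\<mu> \<le> t/2" by (auto simp: c_def max_def split: if_splits)
    have "m \<in> x ` \<sigma>" unfolding m_def using fin ne by (intro Min_in) auto
    then obtain w where w: "w \<in> \<sigma>" "x w = m" by blast
    have "y w = 0" unfolding y_in[OF w(1)] using w(2) \<mu>t by simp
    then have "u \<in> insert v (\<sigma> - {w})" if "y u \<noteq> 0" for u
      using y_out[of u] that by (cases "u \<in> \<sigma>") (auto split: if_splits)
    then show ?thesis using w by blast
  qed
qed

text \<open>The setting for the deformation: all simplices of \<open>L\<close> except the facet \<open>\<sigma>\<close> belong to the star of \<open>v\<close>.
  It is met both by the star of \<open>v\<close> with one further simplex \<open>\<sigma>\<close> and by the boundary of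
  \<open>insert v \<sigma>\<close>, so that the deformation of the former restricts to the latter.\<close>
context
  fixes L :: "'a set set" and \<sigma> :: "'a set" and v :: 'a
  assumes L: "simplicial_complex L" and \<sigma>: "\<sigma> \<in> L" and v: "v \<notin> \<sigma>" and ne: "\<sigma> \<noteq> {}"
    and maximal: "\<And>F. F \<in> L \<Longrightarrow> \<sigma> \<subseteq> F \<Longrightarrow> F = \<sigma>"
    and cone: "\<And>F. F \<in> L \<Longrightarrow> F \<noteq> \<sigma> \<Longrightarrow> insert v F \<in> L"
begin

lemma finite_facet: "finite \<sigma>"
  using simplicial_complexD(1)[OF L \<sigma>] .

lemma facet_min_cases:
  assumes x: "x \<in> topspace (geometric_realization L)"
  shows "0 \<le> (MIN u\<in>\<sigma>. x u)"
    and "(MIN u\<in>\<sigma>. x u) = 0 \<and> supp x \<noteq> \<sigma> \<or> supp x = \<sigma>"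
proof -
  note nonneg = x[unfolded mem_realization, THEN conjunct1, rule_format]
  show "0 \<le> (MIN u\<in>\<sigma>. x u)"
    using Min_eq_0_iff_supp(1)[OF finite_facet ne] nonneg by blast
  have "supp x \<in> L" using x by (simp add: mem_realization)
  then have "\<sigma> \<subseteq> supp x \<longleftrightarrow> supp x = \<sigma>" using maximal[of "supp x"] by (metis order_refl)
  then show "(MIN u\<in>\<sigma>. x u) = 0 \<and> supp x \<noteq> \<sigma> \<or> supp x = \<sigma>"
    using Min_eq_0_iff_supp(2)[OF finite_facet ne, of x] nonneg by simp
qed

lemma push_mem:
  assumes x: "x \<in> topspace (geometric_realization L)" and t: "0 \<le> t" "t \<le> 1"
  shows "push \<sigma> v t x \<in> topspace (geometric_realization L)"
  using facet_min_cases(2)[OF x]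
proof (elim disjE conjE)
  assume m: "(MIN u\<in>\<sigma>. x u) = 0" and s: "supp x \<noteq> \<sigma>"
  have xL: "supp x \<in> L" and nonneg: "\<And>w. 0 \<le> x w" using x by (auto simp: mem_realization)
  let ?A = "insert v (supp x)"
  have A: "?A \<in> L" by (rule cone[OF xL s])
  have fA: "finite ?A" using simplicial_complexD(1)[OF L A] .
  have y: "push \<sigma> v t x = (\<lambda>w. (1 - t) * x w + (if w = v then t else 0))"
    using push_min_0[OF m t(1)] .
  show ?thesis
  proof (rule mem_realizationI[OF fA])
    show sy: "supp (push \<sigma> v t x) \<subseteq> ?A" by (auto simp: y)
    then show "supp (push \<sigma> v t x) \<in> L" using simplicial_complexD(2)[OF L A] by blast
    show "0 \<le> push \<sigma> v t x w" for w using nonneg t by (simp add: y)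
    have "sum x ?A = 1" using sum_realization[OF x fA] by blast
    moreover have "sum (push \<sigma> v t x) ?A = (1 - t) * sum x ?A + (\<Sum>w\<in>?A. if w = v then t else 0)"
      unfolding y sum_distrib_left sum.distrib ..
    moreover have "(\<Sum>w\<in>?A. if w = v then t else 0) = t"
      using fA by (subst sum.delta) auto
    ultimately show "sum (push \<sigma> v t x) ?A = 1" by simp
  qed
next
  assume s: "supp x = \<sigma>"
  have nonneg: "\<And>w. 0 \<le> x w" and "sum x \<sigma> = 1" using x s by (auto simp: mem_realization)
  note y = push_interior[OF finite_facet ne v nonneg s this(2) t]
  let ?y = "push \<sigma> v t x"
  have "supp ?y \<in> L"
    using y(3)
  proof
    show "supp ?y \<subseteq> \<sigma> \<Longrightarrow> supp ?y \<in> L" using simplicial_complexD(2)[OF L \<sigma>] .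
    assume "\<exists>w\<in>\<sigma>. supp ?y \<subseteq> insert v (\<sigma> - {w})"
    then obtain w where w: "w \<in> \<sigma>" "supp ?y \<subseteq> insert v (\<sigma> - {w})" by blast
    have "insert v (\<sigma> - {w}) \<in> L"
      using w simplicial_complexD(2)[OF L \<sigma>, of "\<sigma> - {w}"] by (intro cone) auto
    then show "supp ?y \<in> L" using simplicial_complexD(2)[OF L] w(2) by blast
  qed
  moreover have "supp ?y \<subseteq> insert v \<sigma>" using y(3) by blast
  ultimately show ?thesis
    using y(1,2) finite_facet by (intro mem_realizationI[of "insert v \<sigma>"]) auto
qed

text \<open>At time 1 the points of the star of \<open>v\<close> have arrived at \<open>v\<close> itself, and what is left is the sphere
  formed by \<open>\<sigma>\<close> and the cone from \<open>v\<close> over its boundary.\<close>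
lemma push_end_mem:
  assumes x: "x \<in> topspace (geometric_realization L)"
  shows "push \<sigma> v 1 x \<in> topspace (geometric_realization (simplex_boundary (insert v \<sigma>)))"
  using facet_min_cases(2)[OF x]
proof (elim disjE conjE)
  assume m: "(MIN u\<in>\<sigma>. x u) = 0"
  have y: "push \<sigma> v 1 x = vertex_point v" using push_min_0[OF m] by (auto simp: fun_eq_iff)
  have "{v} \<subset> insert v \<sigma>" using v ne by blast
  then show ?thesis
    by (intro mem_realizationI[of "{v}"]) (auto simp: y simplex_boundary_def)
next
  assume s: "supp x = \<sigma>"
  have nonneg: "\<And>w. 0 \<le> x w" and "sum x \<sigma> = 1" using x s by (auto simp: mem_realization)
  note y = push_interior[OF finite_facet ne v nonneg s this(2), of 1, simplified]
  show ?thesis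
    using y finite_facet v by (intro mem_realizationI[of "insert v \<sigma>"]) (auto simp: simplex_boundary_def)
qed

lemma continuous_map_push:
  "continuous_map (prod_topology (top_of_set {0..1}) (geometric_realization L))
     (geometric_realization L) (\<lambda>(t, x). push \<sigma> v t x)"
proof (rule continuous_map_into_realization)
  let ?P = "prod_topology (top_of_set {0..1::real}) (geometric_realization L)"
  fix w
  have f: "continuous_map ?P euclideanreal fst"
    using continuous_map_fst continuous_map_into_fulltopology by blast
  have coord: "continuous_map ?P euclideanreal (\<lambda>z. snd z u)" for u
    using continuous_map_compose[OF continuous_map_snd continuous_map_coordinate]
    by (simp add: o_def)
  have m: "continuous_map ?P euclideanreal (\<lambda>z. MIN u\<in>\<sigma>. snd z u)"
    by (intro continuous_map_Min finite_facet ne coord)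
  have card: "0 < card \<sigma>" using finite_facet ne by (simp add: card_gt_0_iff)
  have I: "continuous_map ?P euclideanreal (\<lambda>z. if b then f z else g z)"
    if "continuous_map ?P euclideanreal f" "continuous_map ?P euclideanreal g"
    for b and f g :: "real \<times> ('a \<Rightarrow> real) \<Rightarrow> real"
    using that by auto
  have k: "continuous_map ?P euclideanreal (\<lambda>z. r)" for r :: real by simp
  show "continuous_map ?P euclideanreal (\<lambda>z. (case z of (t, x) \<Rightarrow> push \<sigma> v t x) w)"
    unfolding push_def Let_def case_prod_unfold
    by (intro I k continuous_map_add continuous_map_diff continuous_map_real_mult
        continuous_map_real_divide continuous_map_real_max continuous_map_real_min f coord m)
      (use card in \<open>auto simp: min_def\<close>)
qed (use push_mem in auto)

end

lemma push_vertex_point: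
  assumes "finite \<sigma>" "\<sigma> \<noteq> {}" "v \<notin> \<sigma>" "0 \<le> t"
  shows "push \<sigma> v t (vertex_point v) = vertex_point v"
proof -
  have "(MIN u\<in>\<sigma>. vertex_point v u) = 0"
    using assms(2,3) by (subst Min_eq_0_iff_supp[OF assms(1,2)]) auto
  then show ?thesis using push_min_0[of "vertex_point v", OF _ assms(4)] by (auto simp: fun_eq_iff)
qed

text \<open>A point lies in the subcomplex iff for every missing simplex some coordinate vanishes, which is
  the vanishing of a single continuous function.\<close>
lemma closedin_subcomplex:
  assumes K: "simplicial_complex K" "finite K" and L: "simplicial_complex L" "L \<subseteq> K" "{} \<in> L"
  shows "closedin (geometric_realization K) (topspace (geometric_realization L))"
proof -
  let ?X = "geometric_realization K"
  define s where "s x = (\<Sum>F\<in>K - L. MIN u\<in>F. x u)" for x :: "'a \<Rightarrow> real"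
  have F: "finite F" "F \<noteq> {}" if "F \<in> K - L" for F
    using that L(3) simplicial_complexD(1)[OF K(1)] by auto
  have "continuous_map ?X euclideanreal s"
    unfolding s_def by (intro continuous_map_sum continuous_map_Min continuous_map_coordinate F)
      (use K(2) in auto)
  then have "closedin ?X {x \<in> topspace ?X. s x \<in> {0}}"
    by (rule closedin_continuous_map_preimage) simp
  also have "{x \<in> topspace ?X. s x \<in> {0}} = topspace (geometric_realization L)"
  proof (intro set_eqI iffI)
    fix x assume x: "x \<in> {x \<in> topspace ?X. s x \<in> {0}}"
    then have nonneg: "\<And>w. 0 \<le> x w" and xK: "supp x \<in> K" by (auto simp: mem_realization)
    have "supp x \<in> L"
    proof (rule ccontr)
      assume n: "supp x \<notin> L"
      have "\<forall>F\<in>K - L. (MIN u\<in>F. x u) = 0"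
        using x K(2) Min_eq_0_iff_supp(1)[OF F nonneg] by (subst sum_nonneg_eq_0_iff[symmetric]) (auto simp: s_def)
      then have "(MIN u\<in>supp x. x u) = 0" using n xK by blast
      then show False using Min_eq_0_iff_supp(2)[OF F, of "supp x" x] n xK nonneg by blast
    qed
    then show "x \<in> topspace (geometric_realization L)" using x by (simp add: mem_realization)
  next
    fix x assume x: "x \<in> topspace (geometric_realization L)"
    then have nonneg: "\<And>w. 0 \<le> x w" and xL: "supp x \<in> L" by (auto simp: mem_realization)
    have "(MIN u\<in>F. x u) = 0" if "F \<in> K - L" for F
      using Min_eq_0_iff_supp(2)[OF F[OF that], of x] nonneg that simplicial_complexD(2)[OF L(1) xL] by blast
    then have "s x = 0" by (simp add: s_def)
    then show "x \<in> {x \<in> topspace ?X. s x \<in> {0}}"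
      using x L(2) by (auto simp: mem_realization)
  qed
  finally show ?thesis .
qed

section \<open>The boundary of a simplex is a sphere\<close>

text \<open>Radial projection from the barycenter, in linear coordinates chosen so that the direction of the
  vertex \<open>v\<close> becomes the first basis vector, i.e. the base point of the sphere: the coordinate at \<open>v\<close>
  comes first, followed by the differences of the coordinates on \<open>\<sigma>\<close>.\<close>
lemma simplex_boundary_homeomorphic_nsphere:
  assumes fin: "finite \<sigma>" and card: "card \<sigma> = Suc d" and v: "v \<notin> \<sigma>"
  obtains \<theta> \<theta>' where
    "homeomorphic_maps (geometric_realization (simplex_boundary (insert v \<sigma>))) (nsphere d) \<theta> \<theta>'"
    "\<theta> (vertex_point v) = nsphere_basepoint"
proof -
  let ?A = "insert v \<sigma>" and ?T = "geometric_realization (simplex_boundary (insert v \<sigma>))"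
  define N where "N = real d + 2"
  have N: "0 < N" "N - 1 = real d + 1" "N \<noteq> 1" "real (card ?A) = N"
    using fin card v by (auto simp: N_def)
  have finA: "finite ?A" and neA: "?A \<noteq> {}" using fin by auto
  obtain e where e: "bij_betw e {..d} \<sigma>"
    using finite_same_card_bij[of "{..d}" \<sigma>] fin card by auto
  define ix where "ix = the_inv_into {..d} e"
  have e_in: "e i \<in> \<sigma>" if "i \<le> d" for i using e that by (auto simp: bij_betw_def)
  have e_ne: "e i \<noteq> v" if "i \<le> d" for i using e_in[OF that] v by blast
  have ix_e: "ix (e i) = i" if "i \<le> d" for i
    unfolding ix_def using e that by (intro the_inv_into_f_f) (auto simp: bij_betw_def)
  have e_ix: "e (ix w) = w" and ix_le: "ix w \<le> d" if "w \<in> \<sigma>" for w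
  proof -
    have "w \<in> e ` {..d}" using e that by (simp add: bij_betw_def)
    then obtain i where "i \<le> d" "w = e i" by blast
    then show "e (ix w) = w" "ix w \<le> d" using ix_e by auto
  qed
  have sum_e: "sum f \<sigma> = (\<Sum>i\<le>d. f (e i))" for f :: "'a \<Rightarrow> real"
    using sum.reindex_bij_betw[OF e, of f] by simp
  have sumA: "sum f ?A = f v + (\<Sum>i\<le>d. f (e i))" for f :: "'a \<Rightarrow> real"
    using fin v by (simp add: sum_e)
  have d0: "{..d} = insert 0 {1..d}" by auto
  have split0: "(\<Sum>i\<le>d. if i = 0 then a else f i) = a + (\<Sum>i\<in>{1..d}. f i)" for a and f :: "nat \<Rightarrow> real"
    unfolding d0 by (subst sum.insert) (auto intro!: sum.cong)
  have split0': "(\<Sum>i\<le>d. f i) = f 0 + (\<Sum>i\<in>{1..d}. f i)" for f :: "nat \<Rightarrow> real"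
    unfolding d0 by simp

  define l where "l y i = (if i = 0 then y v - 1/N else if i \<le> d then y (e i) - y (e 0) else 0)"
    for y :: "'a \<Rightarrow> real" and i
  define Q where "Q y = sqrt (\<Sum>i\<le>d. (l y i)\<^sup>2)" for y
  define \<theta> where "\<theta> y i = l y i / Q y" for y i

  \<comment> \<open>The inverse: \<open>z s\<close> is the vector with coordinate sum 0 whose image under the coordinates
    above is \<open>s\<close>, the value \<open>a s\<close> at \<open>e 0\<close> being forced by that sum; the ray from the barycenter
    in this direction leaves the simplex when its smallest coordinate becomes 0.\<close>
  define a where "a s = - (\<Sum>i\<le>d. s i) / (real d + 1)" for s :: "nat \<Rightarrow> real"
  define z where "z s w = (if w = v then s 0 else if w \<in> \<sigma> then
      a s + (if ix w = 0 then 0 else s (ix w)) else 0)" for s w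
  define M where "M s = - (MIN w\<in>?A. z s w)" for s
  define \<theta>' where "\<theta>' s w = (if w \<in> ?A then 1/N + z s w / (N * M s) else 0)" for s w

  have z_v: "z s v = s 0" for s
    by (simp add: z_def)
  have z_e: "z s (e i) = a s + (if i = 0 then 0 else s i)" if "i \<le> d" for s i
    by (simp add: z_def that e_in e_ne ix_e)
  have sum_z: "sum (z s) ?A = 0" for s
  proof -
    have "sum (z s) ?A = s 0 + (\<Sum>i\<le>d. a s + (if i = 0 then 0 else s i))"
      unfolding sumA by (simp add: z_v z_e)
    also have "\<dots> = (\<Sum>i\<le>d. s i) + (real d + 1) * a s"
      by (simp add: sum.distrib split0 split0'[of s] algebra_simps)
    also have "\<dots> = 0" by (simp add: a_def)
    finally show ?thesis .
  qed
  have z_nz: "\<exists>w\<in>?A. z s w \<noteq> 0" if s: "s \<in> topspace (nsphere d)" for s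
  proof (rule ccontr)
    assume "\<not> ?thesis"
    then have 0: "z s w = 0" if "w \<in> ?A" for w using that by blast
    have "s 0 = 0" using 0[of v] by (simp add: z_def)
    moreover have "a s = 0" using 0[OF insertI2[OF e_in[of 0]]] z_e[of 0 s] by simp
    moreover have "s i = 0" if "i \<le> d" "i \<noteq> 0" for i
      using 0[OF insertI2[OF e_in[of i]]] z_e[of i s] that \<open>a s = 0\<close> by simp
    ultimately have "(\<Sum>i\<le>d. (s i)\<^sup>2) = 0" by (intro sum.neutral) auto
    then show False using s by (simp add: nsphere)
  qed
  have M_pos: "0 < M s" if s: "s \<in> topspace (nsphere d)" for s
  proof (rule ccontr)
    assume "\<not> 0 < M s"
    then have "0 \<le> z s w" if "w \<in> ?A" for w
      using Min_le[OF finite_imageI[OF finA] imageI[OF that], of "z s"] by (simp add: M_def)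
    then have "\<forall>w\<in>?A. z s w = 0"
      using sum_nonneg_eq_0_iff[OF finA, of "z s"] sum_z by blast
    then show False using z_nz[OF s] by blast
  qed
  have Q_pos: "0 < Q y" if y: "y \<in> topspace ?T" for y
  proof -
    have "(\<Sum>i\<le>d. (l y i)\<^sup>2) \<noteq> 0"
    proof
      assume "(\<Sum>i\<le>d. (l y i)\<^sup>2) = 0"
      then have l0: "l y i = 0" if "i \<le> d" for i
        using that by (subst (asm) sum_nonneg_eq_0_iff) auto
      have yv: "y v = 1/N" using l0[of 0] by (simp add: l_def)
      have ye: "y (e i) = y (e 0)" if "i \<le> d" for i
        using l0[OF that] that by (cases "i = 0") (auto simp: l_def)
      have "sum y ?A = 1"
        using y by (intro sum_realization[OF y finA]) (auto simp: mem_realization simplex_boundary_def)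
      moreover have "(\<Sum>i\<le>d. y (e i)) = (\<Sum>i\<le>d. y (e 0))" by (intro sum.cong ye) auto
      ultimately have "1/N + (real d + 1) * y (e 0) = 1" by (simp add: sumA yv add.commute)
      then have "y (e 0) \<noteq> 0" using N by (auto simp: field_simps)
      then have "y w \<noteq> 0" if "w \<in> ?A" for w
      proof (cases "w = v")
        case True
        then show ?thesis using yv N(1) by simp
      next
        case False
        then have "w \<in> \<sigma>" using that by blast
        then show ?thesis using ye[OF ix_le[of w]] e_ix[of w] \<open>y (e 0) \<noteq> 0\<close> by simp
      qed
      then have "?A \<subseteq> supp y" by blast
      then show False using y by (auto simp: mem_realization simplex_boundary_def)
    qed
    moreover have "0 \<le> (\<Sum>i\<le>d. (l y i)\<^sup>2)" by (intro sum_nonneg) auto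
    ultimately show ?thesis by (simp add: Q_def)
  qed

  have \<theta>_in: "\<theta> y \<in> topspace (nsphere d)" if y: "y \<in> topspace ?T" for y
  proof -
    have "(\<Sum>i\<le>d. (\<theta> y i)\<^sup>2) = (\<Sum>i\<le>d. (l y i)\<^sup>2) / (Q y)\<^sup>2"
      by (simp add: \<theta>_def power_divide sum_divide_distrib)
    also have "(Q y)\<^sup>2 = (\<Sum>i\<le>d. (l y i)\<^sup>2)" unfolding Q_def by (intro real_sqrt_pow2 sum_nonneg) auto
    finally have "(\<Sum>i\<le>d. (\<theta> y i)\<^sup>2) = 1" using Q_pos[OF y] by (auto simp: Q_def)
    then show ?thesis by (simp add: nsphere \<theta>_def l_def)
  qed
  have \<theta>'_in: "\<theta>' s \<in> topspace ?T" if s: "s \<in> topspace (nsphere d)" for s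
  proof (rule mem_realizationI[OF finA])
    note M = M_pos[OF s]
    show "supp (\<theta>' s) \<subseteq> ?A" by (auto simp: \<theta>'_def)
    moreover have "\<exists>w\<in>?A. \<theta>' s w = 0"
    proof -
      have "(MIN w\<in>?A. z s w) \<in> z s ` ?A" using finA by (intro Min_in) auto
      then obtain w where w: "w \<in> ?A" "(MIN w\<in>?A. z s w) = z s w" by blast
      have "z s w = - M s" unfolding M_def w(2) by simp
      with w(1) show ?thesis using M N by (intro bexI[of _ w]) (auto simp: \<theta>'_def)
    qed
    ultimately show "supp (\<theta>' s) \<in> simplex_boundary ?A" by (auto simp: simplex_boundary_def)
    show "0 \<le> \<theta>' s w" for w
    proof (cases "w \<in> ?A")
      case True
      have "- M s \<le> z s w"
        using Min_le[OF finite_imageI[OF finA] imageI[OF True], of "z s"] by (simp add: M_def)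
      moreover have "\<theta>' s w = (M s + z s w) / (N * M s)"
        using True M N(1) by (simp add: \<theta>'_def field_simps)
      ultimately show ?thesis using M N(1) by simp
    qed (simp add: \<theta>'_def)
    have "sum (\<theta>' s) ?A = (\<Sum>w\<in>?A. 1/N) + sum (z s) ?A / (N * M s)"
      by (simp add: \<theta>'_def sum.distrib sum_divide_distrib del: sum.insert)
    also have "(\<Sum>w\<in>?A. 1/N) = 1" using N by (simp del: sum.insert card_insert_disjoint)
    finally show "sum (\<theta>' s) ?A = 1" by (simp add: sum_z)
  qed

  have \<theta>_\<theta>': "\<theta> (\<theta>' s) = s" if s: "s \<in> topspace (nsphere d)" for s
  proof -
    note M = M_pos[OF s]
    have l: "l (\<theta>' s) i = s i / (N * M s)" for i
      using s e_in by (auto simp: l_def \<theta>'_def z_v z_e nsphere add_divide_distrib)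
    have "Q (\<theta>' s) = sqrt ((\<Sum>i\<le>d. (s i)\<^sup>2) / (N * M s)\<^sup>2)"
      by (simp add: Q_def l power_divide sum_divide_distrib)
    also have "\<dots> = 1 / (N * M s)" using s M N by (simp add: nsphere real_sqrt_divide)
    finally show ?thesis using M N by (auto simp: \<theta>_def l fun_eq_iff)
  qed
  have \<theta>'_\<theta>: "\<theta>' (\<theta> y) = y" if y: "y \<in> topspace ?T" for y
  proof -
    note Q = Q_pos[OF y]
    have nonneg: "0 \<le> y w" for w using y by (simp add: mem_realization)
    have sy: "supp y \<subset> ?A" using y by (simp add: mem_realization simplex_boundary_def)
    have sum1: "y v + (\<Sum>i\<le>d. y (e i)) = 1"
      using sum_realization[OF y finA] sy by (simp add: sumA)
    have a: "a (\<theta> y) = (y (e 0) - 1/N) / Q y"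
    proof -
      have "(\<Sum>i\<le>d. l y i) = y v - 1/N + (\<Sum>i\<in>{1..d}. y (e i) - y (e 0))"
        unfolding split0' by (simp add: l_def)
      also have "(\<Sum>i\<in>{1..d}. y (e i) - y (e 0)) = (\<Sum>i\<le>d. y (e i) - y (e 0))"
        unfolding split0' by simp
      also have "\<dots> = 1 - y v - (real d + 1) * y (e 0)"
        using sum1 by (simp add: sum_subtractf algebra_simps)
      finally have "(\<Sum>i\<le>d. l y i) = (1 - 1/N) - (real d + 1) * y (e 0)" by simp
      also have "1 - 1/N = (real d + 1) / N" using N(1) unfolding N(2)[symmetric] by (simp add: diff_divide_distrib)
      finally have "(\<Sum>i\<le>d. l y i) = - (real d + 1) * (y (e 0) - 1/N)"
        by (simp add: algebra_simps add_divide_distrib)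
      then have "a (\<theta> y) = - ((- (real d + 1) * (y (e 0) - 1/N)) / Q y) / (real d + 1)"
        by (simp only: a_def \<theta>_def flip: sum_divide_distrib)
      moreover have "- ((- D * r) / q) / D = r / q" if "D \<noteq> 0" for D r q :: real
        using that by simp
      moreover have "real d + 1 \<noteq> 0" by simp
      ultimately show ?thesis by metis
    qed
    have z: "z (\<theta> y) w = (y w - 1/N) / Q y" if "w \<in> ?A" for w
    proof (cases "w = v")
      case True
      then show ?thesis by (simp add: z_v \<theta>_def l_def)
    next
      case False
      then have "w \<in> \<sigma>" using that by blast
      then obtain i where "i \<le> d" "w = e i" using e_ix ix_le by metis
      then show ?thesis by (simp add: z_e a \<theta>_def l_def diff_divide_distrib)
    qed
    have M: "M (\<theta> y) = 1 / (N * Q y)"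
    proof -
      obtain w where w: "w \<in> ?A" "y w = 0" using sy by blast
      have "(MIN w\<in>?A. z (\<theta> y) w) = - 1 / (N * Q y)"
      proof (rule Min_eqI)
        show "finite (z (\<theta> y) ` ?A)" using finA by blast
        show "- 1 / (N * Q y) \<in> z (\<theta> y) ` ?A"
          using z[OF w(1)] w by (intro image_eqI[of _ _ w]) auto
        show "- 1 / (N * Q y) \<le> b" if "b \<in> z (\<theta> y) ` ?A" for b
          using that nonneg Q N(1) by (auto simp: z divide_simps)
      qed
      then show ?thesis by (simp add: M_def)
    qed
    show ?thesis
    proof
      fix w
      show "\<theta>' (\<theta> y) w = y w"
      proof (cases "w \<in> ?A")
        case True
        then show ?thesis using Q N by (simp add: \<theta>'_def z M)
      next
        case False
        then have "y w = 0" using sy by blast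
        then show ?thesis using False by (simp add: \<theta>'_def)
      qed
    qed
  qed

  have "continuous_map ?T (nsphere d) \<theta>"
  proof -
    have l: "continuous_map ?T euclideanreal (\<lambda>y. l y i)" for i
      unfolding l_def by (cases "i = 0"; cases "i \<le> d"; simp; intro continuous_intros; simp)
    have "continuous_map ?T euclideanreal Q"
      unfolding Q_def by (intro continuous_map_sqrt continuous_map_sum continuous_map_real_pow l) auto
    moreover have "Q y \<noteq> 0" if "y \<in> topspace ?T" for y using Q_pos[OF that] by simp
    ultimately have "continuous_map ?T euclideanreal (\<lambda>y. \<theta> y i)" for i
      unfolding \<theta>_def by (intro continuous_map_real_divide l)
    then show ?thesis
      using \<theta>_in unfolding nsphere
      by (auto simp: continuous_map_in_subtopology continuous_map_componentwise_UNIV)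
  qed
  moreover have "continuous_map (nsphere d) ?T \<theta>'"
  proof (rule continuous_map_into_realization[OF _ \<theta>'_in])
    note s = continuous_map_nsphere_projection[of d]
    have z: "continuous_map (nsphere d) euclideanreal (\<lambda>s. z s w)" for w
      unfolding z_def a_def
      by (cases "w = v"; cases "w \<in> \<sigma>"; cases "ix w = 0"; simp; intro continuous_intros s; simp)
    have "continuous_map (nsphere d) euclideanreal M"
      unfolding M_def by (intro continuous_map_minus continuous_map_Min z finA) auto
    then have "continuous_map (nsphere d) euclideanreal (\<lambda>s. N * M s)"
      by (intro continuous_map_real_mult) auto
    moreover have "N * M s \<noteq> 0" if "s \<in> topspace (nsphere d)" for s
      using M_pos[OF that] N(1) by simp
    ultimately have "continuous_map (nsphere d) euclideanreal (\<lambda>s. 1/N + z s w / (N * M s))" for w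
      by (intro continuous_map_add continuous_map_real_divide z) auto
    then show "continuous_map (nsphere d) euclideanreal (\<lambda>s. \<theta>' s w)" for w
      unfolding \<theta>'_def by (cases "w \<in> ?A") simp_all
  qed
  ultimately have "homeomorphic_maps ?T (nsphere d) \<theta> \<theta>'"
    using \<theta>'_\<theta> \<theta>_\<theta>' by (simp add: homeomorphic_maps_def)
  moreover have "\<theta> (vertex_point v) = nsphere_basepoint"
  proof -
    have l: "l (vertex_point v) i = (if i = 0 then 1 - 1/N else 0)" for i
      using e_ne by (auto simp: l_def)
    have "Q (vertex_point v) = 1 - 1/N"
      unfolding Q_def split0' using N by (simp add: l N_def)
    then show ?thesis using N by (auto simp: \<theta>_def l nsphere_basepoint_def fun_eq_iff)
  qed
  ultimately show ?thesis using that by blast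
qed

section \<open>Gluing simplices to a cone\<close>

text \<open>Each simplex outside the star of \<open>v\<close> is glued to the contractible star along its whole boundary, so
  collapsing the star leaves one sphere for each of them. Instead of forming a quotient, the complex is covered
  by the subcomplexes \<open>L \<sigma>\<close>, the star together with one such simplex \<open>\<sigma>\<close>. The push of \<open>L \<sigma>\<close> ends in the
  boundary of \<open>insert v \<sigma>\<close>, which is a sphere, and on the star all pushes are the same
  straight-line contraction to \<open>v\<close>.\<close>
theorem wedge_of_spheres_if_star_and_facets:
  assumes K: "simplicial_complex K" and fin: "finite K" and v: "{v} \<in> K"
    and out: "\<exists>\<sigma>\<in>K. insert v \<sigma> \<notin> K"
    and faces: "\<And>\<sigma> G. \<sigma> \<in> K \<Longrightarrow> insert v \<sigma> \<notin> K \<Longrightarrow> G \<subset> \<sigma> \<Longrightarrow> insert v G \<in> K"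
  shows "homotopy_wedge_of_spheres (geometric_realization K)"
proof -
  define S where "S = {\<sigma> \<in> K. insert v \<sigma> \<notin> K}"
  define L where "L \<sigma> = insert \<sigma> {F \<in> K. insert v F \<in> K}" for \<sigma>
  let ?Z = "geometric_realization K" and ?B = "\<lambda>\<sigma>. simplex_boundary (insert v \<sigma>)"
  have S: "\<sigma> \<in> K" "insert v \<sigma> \<notin> K" "v \<notin> \<sigma>" "\<sigma> \<noteq> {}" "finite \<sigma>" if "\<sigma> \<in> S" for \<sigma>
  proof -
    show 1: "\<sigma> \<in> K" "insert v \<sigma> \<notin> K" using that by (auto simp: S_def)
    then show "v \<notin> \<sigma>" "\<sigma> \<noteq> {}" "finite \<sigma>"
      using v simplicial_complexD(1)[OF K] by (auto simp: insert_absorb)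
  qed
  have S_max: False if "\<sigma> \<in> S" "\<sigma> \<subseteq> F" "insert v F \<in> K" for \<sigma> F
    using simplicial_complexD(2)[OF K that(3), of "insert v \<sigma>"] S(2)[OF that(1)] that(2) by blast
  have S_face: "G \<in> K \<and> insert v G \<in> K" if "\<sigma> \<in> S" "G \<subset> \<sigma>" for \<sigma> G
    using faces[OF S(1,2)[OF that(1)] that(2)] simplicial_complexD(2)[OF K S(1)[OF that(1)], of G] that(2)
    by blast
  have finS: "finite S" and neS: "S \<noteq> {}" using fin out by (auto simp: S_def)
  have e_in: "{} \<in> K" "insert v {} \<in> K" using v simplicial_complexD(2)[OF K v] by auto
  have L_sub: "L \<sigma> \<subseteq> K" if "\<sigma> \<in> S" for \<sigma> using S(1)[OF that] by (auto simp: L_def)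
  have L_complex: "simplicial_complex (L \<sigma>)" if \<sigma>: "\<sigma> \<in> S" for \<sigma>
    unfolding simplicial_complex_def
  proof (intro ballI conjI allI impI)
    show "finite F" if "F \<in> L \<sigma>" for F
      using that L_sub[OF \<sigma>] simplicial_complexD(1)[OF K] by blast
    fix F G assume F: "F \<in> L \<sigma>" and G: "G \<subseteq> F"
    show "G \<in> L \<sigma>"
    proof (cases "F = \<sigma>")
      case True
      then show ?thesis using S_face[OF \<sigma>, of G] G by (auto simp: L_def)
    next
      case False
      then have "F \<in> K" "insert v F \<in> K" using F by (auto simp: L_def)
      then have "G \<in> K" "insert v G \<in> K"
        using G simplicial_complexD(2)[OF K, of F G]
          simplicial_complexD(2)[OF K, of "insert v F" "insert v G"] by blast+
      then show ?thesis by (simp add: L_def)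
    qed
  qed
  have L_max: "F = \<sigma>" if "\<sigma> \<in> S" "F \<in> L \<sigma>" "\<sigma> \<subseteq> F" for F \<sigma>
    using that S_max[of \<sigma> F] by (auto simp: L_def)
  have L_cone: "insert v F \<in> L \<sigma>" if "\<sigma> \<in> S" "F \<in> L \<sigma>" "F \<noteq> \<sigma>" for F \<sigma>
    using that by (auto simp: L_def)
  have L_self: "\<sigma> \<in> L \<sigma>" for \<sigma> by (simp add: L_def)
  have B_sub: "?B \<sigma> \<subseteq> L \<sigma>" if \<sigma>: "\<sigma> \<in> S" for \<sigma>
  proof
    fix F assume "F \<in> ?B \<sigma>"
    then have F: "F \<subset> insert v \<sigma>" by (simp add: simplex_boundary_def)
    show "F \<in> L \<sigma>"
    proof (cases "F = \<sigma>")
      case False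
      then have "F - {v} \<subset> \<sigma>" using F by blast
      then have "insert v (F - {v}) \<in> L \<sigma>"
        using S_face[OF \<sigma>, of "F - {v}"] by (auto simp: L_def)
      then show ?thesis using simplicial_complexD(2)[OF L_complex[OF \<sigma>], of _ F] by blast
    qed (simp add: L_self)
  qed
  have B_complex: "simplicial_complex (?B \<sigma>)" if "\<sigma> \<in> S" for \<sigma>
    using S(5)[OF that] by (simp add: simplicial_complex_simplex_boundary)
  have B_self: "\<sigma> \<in> ?B \<sigma>" if "\<sigma> \<in> S" for \<sigma>
    using S(3)[OF that] by (auto simp: simplex_boundary_def)
  have B_max: "F = \<sigma>" if "\<sigma> \<in> S" "F \<in> ?B \<sigma>" "\<sigma> \<subseteq> F" for F \<sigma>
    using that by (auto simp: simplex_boundary_def)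
  have B_cone: "insert v F \<in> ?B \<sigma>" if \<sigma>: "\<sigma> \<in> S" and F: "F \<in> ?B \<sigma>" "F \<noteq> \<sigma>" for F \<sigma>
  proof -
    obtain w where "w \<in> \<sigma>" "w \<notin> F" using B_max[OF \<sigma> F(1)] F(2) by blast
    then have "w \<notin> insert v F" "w \<in> insert v \<sigma>" using S(3)[OF \<sigma>] by auto
    moreover have "insert v F \<subseteq> insert v \<sigma>" using F(1) by (auto simp: simplex_boundary_def)
    ultimately show ?thesis unfolding simplex_boundary_def by blast
  qed

  have "\<exists>\<theta> \<theta>'. homeomorphic_maps (geometric_realization (?B \<sigma>)) (nsphere (card \<sigma> - 1)) \<theta> \<theta>' \<and>
      \<theta> (vertex_point v) = nsphere_basepoint" if "\<sigma> \<in> S" for \<sigma>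
  proof -
    have "card \<sigma> = Suc (card \<sigma> - 1)" using S(4,5)[OF that] by (simp add: card_gt_0_iff)
    then show ?thesis using simplex_boundary_homeomorphic_nsphere[OF S(5)[OF that] _ S(3)[OF that]]
      by metis
  qed
  then obtain \<theta> \<theta>' where
    \<theta>: "\<And>\<sigma>. \<sigma> \<in> S \<Longrightarrow>
      homeomorphic_maps (geometric_realization (?B \<sigma>)) (nsphere (card \<sigma> - 1)) (\<theta> \<sigma>) (\<theta>' \<sigma>)"
    and \<theta>v: "\<And>\<sigma>. \<sigma> \<in> S \<Longrightarrow> \<theta> \<sigma> (vertex_point v) = nsphere_basepoint"
    by metis
  have v_in: "vertex_point v \<in> topspace (geometric_realization (?B \<sigma>))" if "\<sigma> \<in> S" for \<sigma>
  proof -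
    have "{v} \<subset> insert v \<sigma>" using S(3,4)[OF that] by blast
    then show ?thesis
      by (intro mem_realizationI[of "{v}"]) (auto simp: simplex_boundary_def)
  qed
  have \<theta>'v: "\<theta>' \<sigma> nsphere_basepoint = vertex_point v" if "\<sigma> \<in> S" for \<sigma>
    using \<theta>[OF that] \<theta>v[OF that] v_in[OF that] by (metis homeomorphic_maps_def)
  have \<theta>_cont: "continuous_map (geometric_realization (?B \<sigma>)) (nsphere (card \<sigma> - 1)) (\<theta> \<sigma>)"
    and \<theta>'_cont: "continuous_map (nsphere (card \<sigma> - 1)) (geometric_realization (?B \<sigma>)) (\<theta>' \<sigma>)"
    if "\<sigma> \<in> S" for \<sigma>
    using \<theta>[OF that] by (auto simp: homeomorphic_maps_def)

  obtain b where b: "bij_betw b {..<card S} S"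
    using ex_bij_betw_nat_finite[OF finS] by (auto simp: atLeast0LessThan)
  have bS: "b i \<in> S" if "i \<in> {..<card S}" for i using b that by (auto simp: bij_betw_def)
  define C where "C i = topspace (geometric_realization (L (b i)))" for i
  have sub_C: "subtopology ?Z (C i) = geometric_realization (L (b i))" if "i \<in> {..<card S}" for i
    using realization_subcomplex[OF L_sub[OF bS[OF that]]] by (simp add: C_def)
  \<comment> \<open>Two of the pieces share only the star of \<open>v\<close>, where the minimum in the push vanishes.\<close>
  have overlap: "(MIN u\<in>b i. x u) = 0"
    if "i \<in> {..<card S}" "j \<in> {..<card S}" "i \<noteq> j" "x \<in> C i" "x \<in> C j" for i j x
  proof -
    note \<sigma> = bS[OF that(1)]
    have x: "x \<in> topspace (geometric_realization (L (b i)))" using that by (simp add: C_def)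
    have "b i \<noteq> b j" using b that by (auto simp: bij_betw_def inj_on_def)
    then have "b i \<notin> L (b j)" using S(2)[OF \<sigma>] by (simp add: L_def)
    moreover have "supp x \<in> L (b j)" using that by (simp add: C_def mem_realization)
    ultimately have "supp x \<noteq> b i" by metis
    then show ?thesis
      using facet_min_cases(2)[OF L_complex[OF \<sigma>] L_self S(3,4)[OF \<sigma>] L_max[OF \<sigma>] L_cone[OF \<sigma>] x]
      by simp
  qed

  have "?Z homotopy_equivalent_space
      wedge_topology (\<lambda>i. nsphere (card (b i) - 1)) (\<lambda>_. nsphere_basepoint) {..<card S}"
  proof (rule homotopy_equivalent_wedge[where C = C and base = "vertex_point v"
        and g = "\<lambda>i. \<theta>' (b i)" and f = "\<lambda>i. \<theta> (b i) \<circ> push (b i) v 1" and H = "\<lambda>i. push (b i) v"])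
    fix i assume i: "i \<in> {..<card S}"
    let ?\<sigma> = "b i"
    note \<sigma> = bS[OF i]
    let ?X = "nsphere (card ?\<sigma> - 1)" and ?BT = "geometric_realization (?B ?\<sigma>)"
    let ?J = "top_of_set {0..1::real}"
    note L_ctx = L_complex[OF \<sigma>] L_self S(3,4)[OF \<sigma>] L_max[OF \<sigma>] L_cone[OF \<sigma>]
    note B_ctx = B_complex[OF \<sigma>] B_self[OF \<sigma>] S(3,4)[OF \<sigma>] B_max[OF \<sigma>] B_cone[OF \<sigma>]
    have BL: "?BT = subtopology (geometric_realization (L ?\<sigma>)) (topspace ?BT)"
      by (rule realization_subcomplex[OF B_sub[OF \<sigma>]])
    show "nsphere_basepoint \<in> topspace ?X"
      using continuous_map_funspace[OF \<theta>_cont[OF \<sigma>]] v_in[OF \<sigma>] \<theta>v[OF \<sigma>] by force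
    show "closedin ?Z (C i)"
      unfolding C_def using closedin_subcomplex[OF K fin L_complex[OF \<sigma>] L_sub[OF \<sigma>]] e_in
      by (simp add: L_def)
    show "continuous_map ?X (subtopology ?Z (C i)) (\<theta>' ?\<sigma>)"
    proof -
      have "continuous_map ?X (subtopology (geometric_realization (L ?\<sigma>)) (topspace ?BT)) (\<theta>' ?\<sigma>)"
        using \<theta>'_cont[OF \<sigma>] BL by simp
      then show ?thesis by (simp add: sub_C[OF i] continuous_map_in_subtopology)
    qed
    show "\<theta>' ?\<sigma> nsphere_basepoint = vertex_point v" using \<theta>'v[OF \<sigma>] .
    have pushL: "continuous_map (prod_topology ?J (geometric_realization (L ?\<sigma>)))
        (geometric_realization (L ?\<sigma>)) (\<lambda>(t, x). push ?\<sigma> v t x)"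
      by (rule continuous_map_push[OF L_ctx])
    have "continuous_map (geometric_realization (L ?\<sigma>)) ?BT (push ?\<sigma> v 1)"
    proof -
      have "continuous_map (geometric_realization (L ?\<sigma>))
          (prod_topology ?J (geometric_realization (L ?\<sigma>))) (\<lambda>x. (1, x))"
        by (intro continuous_map_pairedI) auto
      from continuous_map_compose[OF this pushL]
      have "continuous_map (geometric_realization (L ?\<sigma>)) (geometric_realization (L ?\<sigma>)) (push ?\<sigma> v 1)"
        by (simp add: o_def)
      then have "continuous_map (geometric_realization (L ?\<sigma>))
          (subtopology (geometric_realization (L ?\<sigma>)) (topspace ?BT)) (push ?\<sigma> v 1)"
        using push_end_mem[OF L_ctx] by (auto simp: continuous_map_in_subtopology)
      then show ?thesis using BL by simp
    qed
    then show "continuous_map (subtopology ?Z (C i)) ?X (\<theta> ?\<sigma> \<circ> push ?\<sigma> v 1)"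
      unfolding sub_C[OF i] using \<theta>_cont[OF \<sigma>] by (rule continuous_map_compose)
    show "continuous_map (prod_topology ?J (subtopology ?Z (C i))) ?Z (\<lambda>(t, x). push ?\<sigma> v t x)"
    proof -
      have "continuous_map (prod_topology ?J (subtopology ?Z (C i))) (subtopology ?Z (C i))
          (\<lambda>(t, x). push ?\<sigma> v t x)"
        using pushL by (simp add: sub_C[OF i])
      then show ?thesis using continuous_map_in_subtopology by blast
    qed
    show "homotopic_with (\<lambda>h. h nsphere_basepoint = nsphere_basepoint) ?X ?X
        ((\<theta> ?\<sigma> \<circ> push ?\<sigma> v 1) \<circ> \<theta>' ?\<sigma>) id"
    proof -
      have "homotopic_with (\<lambda>h. h (vertex_point v) = vertex_point v) ?BT ?BT id (push ?\<sigma> v 1)"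
      proof (subst homotopic_with)
        show "\<exists>h. continuous_map (prod_topology ?J ?BT) ?BT h \<and> (\<forall>x\<in>topspace ?BT. h (0, x) = id x) \<and>
            (\<forall>x\<in>topspace ?BT. h (1, x) = push ?\<sigma> v 1 x) \<and>
            (\<forall>t\<in>{0..1}. h (t, vertex_point v) = vertex_point v)"
        proof (intro exI conjI ballI)
          show "continuous_map (prod_topology ?J ?BT) ?BT (\<lambda>(t, x). push ?\<sigma> v t x)"
            by (rule continuous_map_push[OF B_ctx])
          show "(case (0, x) of (t, x) \<Rightarrow> push ?\<sigma> v t x) = id x" if "x \<in> topspace ?BT" for x
            using push_time_0[OF S(5,4)[OF \<sigma>] facet_min_cases(1)[OF B_ctx that]] by simp
          show "(case (t, vertex_point v) of (t, x) \<Rightarrow> push ?\<sigma> v t x) = vertex_point v"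
            if "t \<in> {0..1}" for t
            using push_vertex_point[OF S(5,4,3)[OF \<sigma>], of t] that by simp
        qed simp
      qed (use v_in[OF \<sigma>] in auto)
      then have "homotopic_with (\<lambda>h. h (vertex_point v) = nsphere_basepoint) ?BT ?X
          (\<theta> ?\<sigma> \<circ> id) (\<theta> ?\<sigma> \<circ> push ?\<sigma> v 1)"
        by (rule homotopic_with_compose_continuous_map_left[OF _ \<theta>_cont[OF \<sigma>]]) (simp add: \<theta>v[OF \<sigma>])
      then have "homotopic_with (\<lambda>h. h nsphere_basepoint = nsphere_basepoint) ?X ?X
          ((\<theta> ?\<sigma> \<circ> id) \<circ> \<theta>' ?\<sigma>) ((\<theta> ?\<sigma> \<circ> push ?\<sigma> v 1) \<circ> \<theta>' ?\<sigma>)"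
        by (rule homotopic_with_compose_continuous_map_right[OF _ \<theta>'_cont[OF \<sigma>]]) (simp add: \<theta>'v[OF \<sigma>])
      moreover have "homotopic_with (\<lambda>h. h nsphere_basepoint = nsphere_basepoint) ?X ?X
          ((\<theta> ?\<sigma> \<circ> id) \<circ> \<theta>' ?\<sigma>) id"
      proof (rule homotopic_with_equal)
        show "continuous_map ?X ?X (\<theta> ?\<sigma> \<circ> id \<circ> \<theta>' ?\<sigma>)"
          using continuous_map_compose[OF \<theta>'_cont[OF \<sigma>] \<theta>_cont[OF \<sigma>]] by simp
        show "(\<theta> ?\<sigma> \<circ> id \<circ> \<theta>' ?\<sigma>) y = id y" if "y \<in> topspace ?X" for y
          using \<theta>[OF \<sigma>] that by (simp add: homeomorphic_maps_def)
      qed (simp_all add: \<theta>v[OF \<sigma>] \<theta>'v[OF \<sigma>])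
      ultimately show ?thesis using homotopic_with_symD homotopic_with_trans by blast
    qed
    fix x assume x: "x \<in> C i"
    show "push ?\<sigma> v 0 x = x"
      using push_time_0[OF S(5,4)[OF \<sigma>] facet_min_cases(1)[OF L_ctx]] x by (simp add: C_def)
    have "push ?\<sigma> v 1 x \<in> topspace ?BT" using push_end_mem[OF L_ctx] x by (simp add: C_def)
    then show "push ?\<sigma> v 1 x = \<theta>' ?\<sigma> ((\<theta> ?\<sigma> \<circ> push ?\<sigma> v 1) x)"
      using \<theta>[OF \<sigma>] by (simp add: homeomorphic_maps_def)
    fix j assume j: "j \<in> {..<card S}" "i \<noteq> j" "x \<in> C j"
    have m: "(MIN u\<in>b i. x u) = 0" "(MIN u\<in>b j. x u) = 0"
      using overlap[OF i j(1,2) x j(3)] overlap[OF j(1) i _ j(3) x] j(2) by auto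
    then show "push (b i) v t x = push (b j) v t x" if "t \<in> {0..1}" for t
      using push_min_0[of x "b i" t v] push_min_0[of x "b j" t v] that by simp
    have "push ?\<sigma> v 1 x = vertex_point v"
      using push_min_0[OF m(1), of 1 v] by (auto simp: fun_eq_iff)
    then show "(\<theta> ?\<sigma> \<circ> push ?\<sigma> v 1) x = nsphere_basepoint" by (simp add: \<theta>v[OF \<sigma>])
  next
    show "topspace ?Z \<subseteq> (\<Union>i\<in>{..<card S}. C i)"
    proof
      fix x assume x: "x \<in> topspace ?Z"
      obtain \<sigma>0 where \<sigma>0: "\<sigma>0 \<in> S" using neS by blast
      define \<sigma> where "\<sigma> = (if supp x \<in> S then supp x else \<sigma>0)"
      have "\<sigma> \<in> S" "supp x \<in> L \<sigma>"
        using x \<sigma>0 by (auto simp: \<sigma>_def L_def S_def mem_realization)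
      moreover obtain i where "i \<in> {..<card S}" "b i = \<sigma>"
        using b \<open>\<sigma> \<in> S\<close> unfolding bij_betw_def by (metis imageE)
      ultimately show "x \<in> (\<Union>i\<in>{..<card S}. C i)"
        using x by (auto simp: C_def mem_realization)
    qed
  qed simp
  then show ?thesis
    unfolding homotopy_wedge_of_spheres_def sphere_wedge_def
    using finS neS by (intro exI[of _ "{..<card S}"] exI[of _ "\<lambda>i. card (b i) - 1"]) (auto simp: card_gt_0_iff lessThan_empty_iff)
qed

section \<open>Paths in bipartite graphs\<close>

text \<open>Multiple arcs are excluded and arcs come in opposite pairs, so a subgraph isomorphic to the path is
  determined by its vertices in path order.\<close>
lemma subgraph_iso_path_iff:
  assumes "graph G" and F: "F \<subseteq> verts G"
  shows "(\<exists>H. subgraph H (G \<restriction> F) \<and> digraph_iso H (path_graph t)) \<longleftrightarrow>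
    (\<exists>f. inj_on f {..<t} \<and> f ` {..<t} \<subseteq> F \<and>
      (\<forall>i. Suc i < t \<longrightarrow> (f i, f (Suc i)) \<in> arcs_ends G))"
    (is "?L \<longleftrightarrow> ?R")
proof -
  interpret graph G by fact
  show ?thesis
  proof
    assume ?L
    then obtain H h where sub: "subgraph H (G \<restriction> F)"
      and iso: "pre_digraph.digraph_isomorphism H h" and eq: "path_graph t = app_iso h H"
      by (auto simp: digraph_iso_def)
    have H: "verts H \<subseteq> F" "arcs H \<subseteq> arcs G" "tail H = tail G" "head H = head G" "wf_digraph H"
      using sub by (auto simp: subgraph_def compatible_def)
    interpret H: wf_digraph H by (rule H)
    have inj: "inj_on (iso_verts h) (verts H)"
      and ends: "\<And>a. a \<in> arcs H \<Longrightarrow> iso_verts h (tail H a) = iso_tail h (iso_arcs h a) \<and>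
        iso_verts h (head H a) = iso_head h (iso_arcs h a)"
      using iso by (auto simp: pre_digraph.digraph_isomorphism_def)
    have img: "iso_verts h ` verts H = {..<t}"
      "iso_arcs h ` arcs H = {(i, j). i < t \<and> j < t \<and> (j = Suc i \<or> i = Suc j)}"
      "iso_tail h = fst" "iso_head h = snd"
      using eq by (simp_all add: path_graph_def app_iso_def)
    define f where "f = inv_into (verts H) (iso_verts h)"
    have f_h: "f (iso_verts h x) = x" if "x \<in> verts H" for x
      using inj that by (simp add: f_def)
    have "(f i, f (Suc i)) \<in> arcs_ends G" if i: "Suc i < t" for i
    proof -
      have "(i, Suc i) \<in> iso_arcs h ` arcs H" unfolding img using i by simp
      then obtain a where a: "a \<in> arcs H" "iso_arcs h a = (i, Suc i)" by force
      have "f i = tail H a" "f (Suc i) = head H a"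
        using ends[OF a(1)] a f_h[of "tail H a"] f_h[of "head H a"] by (auto simp: img)
      then show ?thesis
        using a(1) H by (auto simp: arcs_ends_conv)
    qed
    moreover have "inj_on f {..<t}"
      unfolding f_def img(1)[symmetric] by (rule inj_on_inv_into) simp
    moreover have "f ` {..<t} \<subseteq> F"
      unfolding f_def using inv_into_into[of _ "iso_verts h" "verts H"] H(1) img(1) by blast
    ultimately show ?R by blast
  next
    assume ?R
    then obtain f where inj: "inj_on f {..<t}" and fF: "f ` {..<t} \<subseteq> F"
      and adj: "\<And>i. Suc i < t \<Longrightarrow> (f i, f (Suc i)) \<in> arcs_ends G" by blast
    define P where "P = {(i, j). i < t \<and> j < t \<and> (j = Suc i \<or> i = Suc j)}"
    define g where "g = the_inv_into {..<t} f"
    have g_f: "g (f i) = i" if "i < t" for i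
      using that inj by (simp add: g_def the_inv_into_f_f)
    define H where "H = \<lparr> verts = f ` {..<t},
      arcs = {a \<in> arcs G. \<exists>(i, j) \<in> P. tail G a = f i \<and> head G a = f j},
      tail = tail G, head = head G \<rparr>"
    define h where "h = (\<lparr> iso_verts = g, iso_arcs = (\<lambda>a. (g (tail G a), g (head G a))),
      iso_head = snd, iso_tail = fst \<rparr> :: ('a, 'b, nat, nat \<times> nat) digraph_isomorphism)"
    have wf: "wf_digraph H"
      by unfold_locales (auto simp: H_def P_def)
    have "wf_digraph (G \<restriction> F)"
      by unfold_locales (auto simp: induce_subgraph_def)
    then have "subgraph H (G \<restriction> F)"
      using wf fF by (auto simp: subgraph_def compatible_def H_def P_def induce_subgraph_def)
    moreover have "pre_digraph.digraph_isomorphism H h"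
      unfolding pre_digraph.digraph_isomorphism_def
    proof (intro conjI wf)
      show "inj_on (iso_verts h) (verts H)"
        by (rule inj_onI) (auto simp: h_def H_def g_f)
      show "inj_on (iso_arcs h) (arcs H)"
      proof (rule inj_onI)
        fix a b assume "a \<in> arcs H" "b \<in> arcs H" "iso_arcs h a = iso_arcs h b"
        then show "a = b"
          by (intro no_multi_arcs) (auto simp: H_def h_def P_def g_f arc_to_ends_def)
      qed
    qed (auto simp: h_def H_def)
    moreover have "path_graph t = app_iso h H"
    proof -
      have "g ` f ` {..<t} = {..<t}" using g_f by force
      moreover have "iso_arcs h ` arcs H = P"
      proof
        show "iso_arcs h ` arcs H \<subseteq> P" by (auto simp: h_def H_def P_def g_f)
        show "P \<subseteq> iso_arcs h ` arcs H"
        proof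
          fix p assume p: "p \<in> P"
          obtain i j where ij: "p = (i, j)" by (cases p)
          have "(f i, f j) \<in> arcs_ends G"
            using p adj[of i] adj[of j] arcs_ends_symmetric[OF sym_arcs] by (auto simp: P_def ij)
          then obtain a where a: "a \<in> arcs G" "tail G a = f i" "head G a = f j" by auto
          then have "a \<in> arcs H" using p by (auto simp: H_def ij)
          moreover have "iso_arcs h a = p" using a p g_f by (auto simp: h_def ij P_def)
          ultimately show "p \<in> iso_arcs h ` arcs H" by blast
        qed
      qed
      ultimately show ?thesis
        by (simp add: path_graph_def app_iso_def P_def) (simp add: h_def H_def)
    qed
    ultimately show ?L by (auto simp: digraph_iso_def)
  qed
qed

text \<open>The even positions use up \<open>(t + 1) div 2\<close> vertices of \<open>U\<close>, the odd ones \<open>t div 2\<close> vertices of \<open>V\<close>, and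
  any such vertices can be interleaved.\<close>
lemma alternating_injection_iff:
  assumes fin: "finite F" and disj: "U \<inter> V = {}"
  shows "(\<exists>f. inj_on f {..<t} \<and> (\<forall>i<t. f i \<in> F \<inter> (if even i then U else V))) \<longleftrightarrow>
    (t + 1) div 2 \<le> card (F \<inter> U) \<and> t div 2 \<le> card (F \<inter> V)"
proof
  assume "\<exists>f. inj_on f {..<t} \<and> (\<forall>i<t. f i \<in> F \<inter> (if even i then U else V))"
  then obtain f where inj: "inj_on f {..<t}"
    and f: "\<And>i. i < t \<Longrightarrow> f i \<in> F \<inter> (if even i then U else V)" by blast
  have "card {..<(t + 1) div 2} \<le> card (F \<inter> U)"
  proof (rule card_inj_on_le)
    show "inj_on (\<lambda>i. f (2 * i)) {..<(t + 1) div 2}"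
      by (rule inj_onI, drule inj_onD[OF inj]) auto
    show "(\<lambda>i. f (2 * i)) ` {..<(t + 1) div 2} \<subseteq> F \<inter> U"
    proof (rule image_subsetI)
      fix i assume "i \<in> {..<(t + 1) div 2}"
      then have "2 * i < t" by auto
      from f[OF this] show "f (2 * i) \<in> F \<inter> U" by simp
    qed
  qed (use fin in auto)
  moreover have "card {..<t div 2} \<le> card (F \<inter> V)"
  proof (rule card_inj_on_le)
    show "inj_on (\<lambda>i. f (2 * i + 1)) {..<t div 2}"
      by (rule inj_onI, drule inj_onD[OF inj]) auto
    show "(\<lambda>i. f (2 * i + 1)) ` {..<t div 2} \<subseteq> F \<inter> V"
    proof (rule image_subsetI)
      fix i assume "i \<in> {..<t div 2}"
      then have "2 * i + 1 < t" by auto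
      from f[OF this] show "f (2 * i + 1) \<in> F \<inter> V" by simp
    qed
  qed (use fin in auto)
  ultimately show "(t + 1) div 2 \<le> card (F \<inter> U) \<and> t div 2 \<le> card (F \<inter> V)" by simp
next
  assume le: "(t + 1) div 2 \<le> card (F \<inter> U) \<and> t div 2 \<le> card (F \<inter> V)"
  obtain g where g: "bij_betw g {0..<card (F \<inter> U)} (F \<inter> U)"
    using ex_bij_betw_nat_finite[of "F \<inter> U"] fin by auto
  obtain h where h: "bij_betw h {0..<card (F \<inter> V)} (F \<inter> V)"
    using ex_bij_betw_nat_finite[of "F \<inter> V"] fin by auto
  have g': "g i \<in> F \<inter> U" "g i = g j \<longleftrightarrow> i = j" if "i < card (F \<inter> U)" "j < card (F \<inter> U)" for i j
    using g that by (auto simp: bij_betw_def dest: inj_onD)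
  have h': "h i \<in> F \<inter> V" "h i = h j \<longleftrightarrow> i = j" if "i < card (F \<inter> V)" "j < card (F \<inter> V)" for i j
    using h that by (auto simp: bij_betw_def dest: inj_onD)
  define f where "f i = (if even i then g (i div 2) else h (i div 2))" for i
  have ev: "i div 2 < card (F \<inter> U)" if "i < t" "even i" for i
    using that le by (elim evenE) auto
  have od: "i div 2 < card (F \<inter> V)" if "i < t" "odd i" for i
    using that le by (elim oddE) auto
  have mem: "f i \<in> F \<inter> (if even i then U else V)" if "i < t" for i
    using g'(1)[OF ev ev, of i i] h'(1)[OF od od, of i i] that by (auto simp: f_def)
  have "inj_on f {..<t}"
  proof (rule inj_onI)
    fix i j assume ij: "i \<in> {..<t}" "j \<in> {..<t}" "f i = f j"
    then have par: "even i \<longleftrightarrow> even j" using mem[of i] mem[of j] disj by (auto split: if_splits)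
    then have "i div 2 = j div 2"
      using ij g'(2)[OF ev ev, of i j] h'(2)[OF od od, of i j] by (auto simp: f_def split: if_splits)
    then show "i = j" using par by (metis div_mult_mod_eq even_iff_mod_2_eq_zero odd_iff_mod_2_eq_one)
  qed
  then show "\<exists>f. inj_on f {..<t} \<and> (\<forall>i<t. f i \<in> F \<inter> (if even i then U else V))"
    using mem by blast
qed

lemma bipartite_walk_iff:
  assumes fin: "finite F" and disj: "U \<inter> V = {}" and F: "F \<subseteq> U \<union> V"
  shows "(\<exists>f. inj_on f {..<t} \<and> f ` {..<t} \<subseteq> F \<and>
      (\<forall>i. Suc i < t \<longrightarrow> (f i, f (Suc i)) \<in> U \<times> V \<union> V \<times> U)) \<longleftrightarrow>
    (t + 1) div 2 \<le> card (F \<inter> U) \<and> t div 2 \<le> card (F \<inter> V) \<or>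
    t div 2 \<le> card (F \<inter> U) \<and> (t + 1) div 2 \<le> card (F \<inter> V)"
    (is "?L \<longleftrightarrow> ?R")
proof -
  define alt where "alt A B f \<longleftrightarrow> inj_on f {..<t} \<and> (\<forall>i<t. f i \<in> F \<inter> (if even i then A else B))"
    for A B and f :: "nat \<Rightarrow> 'a"
  have step: "alt A B f"
    if f: "inj_on f {..<t}" "f ` {..<t} \<subseteq> F" and "f 0 \<in> A" "A \<inter> B = {}"
      and adj: "\<And>i. Suc i < t \<Longrightarrow> (f i, f (Suc i)) \<in> A \<times> B \<union> B \<times> A" for A B and f :: "nat \<Rightarrow> 'a"
  proof -
    have "f i \<in> (if even i then A else B)" if "i < t" for i
      using that
    proof (induction i)
      case (Suc i)
      then show ?case using adj[of i] \<open>A \<inter> B = {}\<close> by (auto split: if_splits)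
    qed (use \<open>f 0 \<in> A\<close> in simp)
    then show ?thesis using f unfolding alt_def by blast
  qed
  have adj: "(f i, f (Suc i)) \<in> A \<times> B \<union> B \<times> A" if "alt A B f" "Suc i < t" for A B f i
  proof -
    have "f i \<in> F \<inter> (if even i then A else B)" "f (Suc i) \<in> F \<inter> (if even (Suc i) then A else B)"
      using that(1) that(2) Suc_lessD[OF that(2)] unfolding alt_def by blast+
    then show ?thesis by (cases "even i") auto
  qed
  have "?L \<longleftrightarrow> (\<exists>f. alt U V f) \<or> (\<exists>f. alt V U f)"
  proof
    assume ?L
    then obtain f where f: "inj_on f {..<t}" "f ` {..<t} \<subseteq> F"
      "\<And>i. Suc i < t \<Longrightarrow> (f i, f (Suc i)) \<in> U \<times> V \<union> V \<times> U" by blast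
    show "(\<exists>f. alt U V f) \<or> (\<exists>f. alt V U f)"
    proof (cases "t = 0")
      case True
      then show ?thesis by (simp add: alt_def)
    next
      case False
      then have "f 0 \<in> U \<or> f 0 \<in> V" using f(2) F by blast
      then show ?thesis
        using step[OF f(1,2) _ disj f(3)] step[OF f(1,2), of V U] f(3) disj by blast
    qed
  next
    have "?L" if "alt U V f \<or> alt V U f" for f
    proof -
      have "(f i, f (Suc i)) \<in> U \<times> V \<union> V \<times> U" if "Suc i < t" for i
        using \<open>alt U V f \<or> alt V U f\<close> adj[OF _ that, of U V f] adj[OF _ that, of V U f] by blast
      moreover have "inj_on f {..<t}" "f ` {..<t} \<subseteq> F" using that by (auto simp: alt_def)
      ultimately show ?thesis by blast
    qed
    then show "(\<exists>f. alt U V f) \<or> (\<exists>f. alt V U f) \<Longrightarrow> ?L" by blast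
  qed
  also have "\<dots> \<longleftrightarrow> ?R"
    unfolding alt_def using alternating_injection_iff[OF fin disj, of t]
      alternating_injection_iff[OF fin, of V U t] disj by (auto simp: Int_commute)
  finally show ?thesis .
qed

lemma nth_vwalk_arcs:
  "Suc i < length p \<Longrightarrow> (p ! i, p ! Suc i) \<in> set (vwalk_arcs p)"
proof (induction p arbitrary: i rule: vwalk_arcs.induct)
  case (3 x y xs)
  then show ?case by (cases i) auto
qed auto

lemma walk_of_length_le_longest_path:
  assumes "graph G" and ne: "verts G \<noteq> {}" and t: "t \<le> longest_path_length G + 1"
  obtains f where "inj_on f {..<t}" "f ` {..<t} \<subseteq> verts G"
    "\<And>i. Suc i < t \<Longrightarrow> (f i, f (Suc i)) \<in> arcs_ends G"
proof -
  interpret graph G by fact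
  let ?P = "{p. vpath p G}"
  have "?P \<subseteq> {p. set p \<subseteq> verts G \<and> distinct p}" by (auto simp: vpath_def vwalk_def)
  then have fin: "finite ?P"
    using finite_subset_distinct[OF finite_verts] finite_subset by blast
  obtain x where "x \<in> verts G" using ne by blast
  then have "[x] \<in> ?P" by (simp add: vpath_def vwalk_def)
  then have "longest_path_length G \<in> vwalk_length ` ?P"
    unfolding longest_path_length_def using fin by (intro Max_in) auto
  then obtain p where p: "vpath p G" "longest_path_length G = length p - 1" by auto
  have len: "t \<le> length p" using p t by (cases p) (auto simp: vpath_def vwalk_def)
  show ?thesis
  proof (rule that[of "(!) p"])
    show "inj_on ((!) p) {..<t}"
      using p len by (auto simp: inj_on_def vpath_def nth_eq_iff_index_eq)
    show "(!) p ` {..<t} \<subseteq> verts G"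
      using p len by (auto simp: vpath_def vwalk_def)
    show "(p ! i, p ! Suc i) \<in> arcs_ends G" if "Suc i < t" for i
      using nth_vwalk_arcs[of i p] that len p by (auto simp: vpath_def vwalk_def)
  qed
qed

section \<open>Path-free complexes of complete bipartite graphs\<close>

text \<open>For \<open>e \<le> 1\<close> these are the vertex sets in \<open>K\<^bsub>m,n\<^esub>\<close> without a path on \<open>2 * k + e\<close> vertices. For
  \<open>e = 1\<close> the last disjunct contributes the sets with exactly \<open>k\<close> vertices on both sides.\<close>
definition bounded_sides :: "'a set \<Rightarrow> 'a set \<Rightarrow> nat \<Rightarrow> nat \<Rightarrow> 'a set set" where
  "bounded_sides U V k e = {F. F \<subseteq> U \<union> V \<and>
     (card (F \<inter> U) < k \<or> card (F \<inter> V) < k \<or> card (F \<inter> U) < k + e \<and> card (F \<inter> V) < k + e)}"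

lemma path_free_complex_bipartite:
  assumes G: "graph G" "verts G = U \<union> V" "U \<inter> V = {}" "arcs_ends G = U \<times> V \<union> V \<times> U"
    and e: "e \<le> 1"
  shows "path_free_complex (2 * k + e) G = bounded_sides U V k e"
proof -
  interpret graph G by fact
  have half: "(2 * k + e + 1) div 2 = k + e" "(2 * k + e) div 2 = k" using e by auto
  have "F \<in> path_free_complex (2 * k + e) G \<longleftrightarrow> F \<in> bounded_sides U V k e" for F
  proof (cases "F \<subseteq> U \<union> V")
    case True
    then have F: "finite F" using finite_verts G(2) finite_subset by metis
    have "F \<in> path_free_complex (2 * k + e) G \<longleftrightarrow>
        \<not> (\<exists>H. subgraph H (G \<restriction> F) \<and> digraph_iso H (path_graph (2 * k + e)))"
      using True by (simp add: path_free_complex_def G(2))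
    also have "\<dots> \<longleftrightarrow> \<not> (k + e \<le> card (F \<inter> U) \<and> k \<le> card (F \<inter> V) \<or>
        k \<le> card (F \<inter> U) \<and> k + e \<le> card (F \<inter> V))"
      by (subst subgraph_iso_path_iff[OF G(1) True[folded G(2)]])
        (simp only: G(4) bipartite_walk_iff[OF F G(3) True] half)
    also have "\<dots> \<longleftrightarrow> F \<in> bounded_sides U V k e"
      using True by (auto simp: bounded_sides_def)
    finally show ?thesis .
  qed (auto simp: path_free_complex_def bounded_sides_def G(2))
  then show ?thesis by blast
qed

lemma bounded_sides_subset:
  assumes fin: "finite U" "finite V" and F: "F \<in> bounded_sides U V k e" and G: "G \<subseteq> F"
  shows "G \<in> bounded_sides U V k e"
proof -
  have "card (G \<inter> U) \<le> card (F \<inter> U)" "card (G \<inter> V) \<le> card (F \<inter> V)"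
    using fin G by (auto intro!: card_mono)
  then show ?thesis using F G by (auto simp: bounded_sides_def)
qed

text \<open>Fix \<open>u \<in> U\<close> and \<open>v \<in> V\<close>. The simplices outside the star of \<open>v\<close> have \<open>k - 1\<close> vertices in \<open>V\<close> and at
  least \<open>k + e\<close> in \<open>U\<close>, or, when \<open>e = 1\<close>, exactly \<open>k\<close> vertices on each side. Among the first kind, toggling \<open>u\<close>
  pairs off all but those that contain \<open>u\<close> and have exactly \<open>k + e\<close> vertices in \<open>U\<close>; the paired ones, the
  set \<open>C\<close> below, are collapsed away. All simplices then left outside the star have \<open>2 * k + e - 1\<close> vertices,
  and all their proper faces lie in the star.\<close>
theorem wedge_of_spheres_bounded_sides:
  assumes fin: "finite U" "finite V" and disj: "U \<inter> V = {}"
    and k: "1 \<le> k" "k \<le> card U" "k + e \<le> card V" and e: "e \<le> 1"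
  shows "homotopy_wedge_of_spheres (geometric_realization (bounded_sides U V k e))"
proof -
  let ?K = "bounded_sides U V k e"
  obtain u v where u: "u \<in> U" and v: "v \<in> V" using k by (metis card.empty all_not_in_conv add_is_0 le_zero_eq not_one_le_zero)
  have uv: "u \<notin> V" "v \<notin> U" using u v disj by auto
  define C where "C = {F. F \<subseteq> U \<union> V \<and> v \<notin> F \<and> Suc (card (F \<inter> V)) = k \<and> k + e \<le> card (F \<inter> U - {u})}"
  define L where "L = ?K - C"
  have fin': "finite (F \<inter> U)" "finite (F \<inter> V)" "finite (F \<inter> U - {u})" for F using fin by auto
  have finK: "finite ?K"
    by (rule finite_subset[of _ "Pow (U \<union> V)"]) (use fin in \<open>auto simp: bounded_sides_def\<close>)
  have C_K: "C \<subseteq> ?K" by (auto simp: C_def bounded_sides_def)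
  have K: "simplicial_complex ?K"
    unfolding simplicial_complex_def
  proof (intro ballI conjI allI impI)
    show "finite F" if "F \<in> ?K" for F
      using that fin finite_subset[of F "U \<union> V"] by (auto simp: bounded_sides_def)
  qed (rule bounded_sides_subset[OF fin])
  have L: "simplicial_complex L"
    unfolding simplicial_complex_def
  proof (intro ballI conjI allI impI)
    show "finite F" if "F \<in> L" for F
      using that simplicial_complexD(1)[OF K] by (auto simp: L_def)
    fix F G assume F: "F \<in> L" and G: "G \<subseteq> F"
    have "G \<notin> C"
    proof
      assume GC: "G \<in> C"
      have "card (G \<inter> U - {u}) \<le> card (F \<inter> U - {u})" "card (F \<inter> U - {u}) \<le> card (F \<inter> U)"
        "card (G \<inter> V) \<le> card (F \<inter> V)"
        using fin' G by (auto intro!: card_mono)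
      then have b: "k + e \<le> card (F \<inter> U - {u})" "card (F \<inter> V) = card (G \<inter> V)"
        using F GC by (auto simp: L_def C_def bounded_sides_def)
      have "G \<inter> V = F \<inter> V"
        using card_subset_eq[OF fin'(2), of "G \<inter> V" F] b(2) G by auto
      then have "v \<notin> F" using GC v by (auto simp: C_def)
      then have "F \<in> C" using F GC b by (auto simp: C_def L_def bounded_sides_def)
      then show False using F by (simp add: L_def)
    qed
    then show "G \<in> L" using F G bounded_sides_subset[OF fin, of F k e G] by (simp add: L_def)
  qed
  have star_C: "insert v F \<notin> C" for F by (simp add: C_def)

  have "geometric_realization ?K homotopy_equivalent_space geometric_realization L"
  proof (rule collapse_by_toggling[OF K L])
    show "L \<subseteq> ?K" by (auto simp: L_def)
    show "finite ?K" by (rule finK)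
    show "{} \<in> L" using k(1) by (auto simp: L_def C_def bounded_sides_def)
    have KL: "?K - L = C" using C_K by (auto simp: L_def)
    show "insert u F \<in> ?K" if "F \<in> ?K - L" for F
      using that u uv unfolding KL by (auto simp: C_def bounded_sides_def)
    show "F - {u} \<notin> L" if "F \<in> ?K - L" for F
    proof -
      have "(F - {u}) \<inter> V = F \<inter> V" "(F - {u}) \<inter> U - {u} = F \<inter> U - {u}" using uv by auto
      then have "F - {u} \<in> C" using that unfolding KL by (auto simp: C_def)
      then show ?thesis by (simp add: L_def)
    qed
  qed
  moreover have "homotopy_wedge_of_spheres (geometric_realization L)"
  proof (rule wedge_of_spheres_if_star_and_facets[OF L])
    show "finite L"
      using finK by (simp add: L_def)
    show "{v} \<in> L" using v uv k(1) by (auto simp: L_def C_def bounded_sides_def)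
  next

    \<comment> \<open>A simplex outside the star with \<open>k\<close> vertices in \<open>U\<close>, among them \<open>u\<close>, and \<open>k + e - 1\<close> in \<open>V\<close>;
      it witnesses for both parities that the wedge is not empty.\<close>
    have "k - 1 \<le> card (U - {u})" "k + e - 1 \<le> card (V - {v})" using k u v fin by simp_all
    then obtain A B where A: "A \<subseteq> U - {u}" "card A = k - 1"
      and B: "B \<subseteq> V - {v}" "card B = k + e - 1"
      by (meson obtain_subset_with_card_n)
    let ?\<sigma> = "insert u A \<union> B"
    have fAB: "finite A" "finite B" using A B fin finite_subset by blast+
    have eqs: "?\<sigma> \<inter> U = insert u A" "?\<sigma> \<inter> V = B" "insert v ?\<sigma> \<inter> U = insert u A" "insert v ?\<sigma> \<inter> V = insert v B"
      using A B u v uv disj by auto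
    have "u \<notin> A" "v \<notin> B" using A B by auto
    then have cards: "card (?\<sigma> \<inter> U) = k" "Suc (card (?\<sigma> \<inter> V)) = k + e"
      "card (insert v ?\<sigma> \<inter> U) = k" "card (insert v ?\<sigma> \<inter> V) = k + e" "card (?\<sigma> \<inter> U - {u}) = k - 1"
      using A(2) B(2) fAB k(1) unfolding eqs by auto
    have sub: "?\<sigma> \<subseteq> U \<union> V" using A B u by auto
    have "?\<sigma> \<in> ?K" using sub cards e by (auto simp: bounded_sides_def)
    moreover have "?\<sigma> \<notin> C"
    proof -
      have "\<not> k + e \<le> k - 1" using k(1) by arith
      then show ?thesis unfolding C_def using cards(5) by simp
    qed
    moreover have "insert v ?\<sigma> \<notin> ?K" using cards by (simp add: bounded_sides_def)
    ultimately show "\<exists>\<sigma>\<in>L. insert v \<sigma> \<notin> L" by (auto simp: L_def)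
  next
    fix \<sigma> G assume \<sigma>: "\<sigma> \<in> L" and out: "insert v \<sigma> \<notin> L" and G: "G \<subset> \<sigma>"
    have v\<sigma>: "v \<notin> \<sigma>" using \<sigma> out by (auto simp: insert_absorb)
    have sub: "\<sigma> \<subseteq> U \<union> V" using \<sigma> by (auto simp: L_def bounded_sides_def)
    have outK: "insert v \<sigma> \<notin> ?K" using out star_C by (simp add: L_def)
    have ins: "insert v F \<inter> U = F \<inter> U" "card (insert v F \<inter> V) = Suc (card (F \<inter> V))" if "v \<notin> F" for F
      using uv v fin'(2) that by auto
    define a where "a = card (\<sigma> \<inter> U)"
    define b where "b = card (\<sigma> \<inter> V)"
    define a' where "a' = card (G \<inter> U)"
    define b' where "b' = card (G \<inter> V)"
    have out': "k \<le> a" "k \<le> Suc b" "k + e \<le> a \<or> k + e \<le> Suc b"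
      using outK sub v v\<sigma> ins[OF v\<sigma>] by (auto simp: bounded_sides_def a_def b_def)
    have in': "b < k \<or> b < k + e \<and> a < k + e"
      using \<sigma> out'(1) by (auto simp: L_def bounded_sides_def a_def b_def)
    have low: "a \<le> k + e" if "Suc b = k"
    proof -
      have "\<not> k + e \<le> card (\<sigma> \<inter> U - {u})" using \<sigma> sub v\<sigma> that by (auto simp: L_def C_def b_def)
      moreover have "a \<le> Suc (card (\<sigma> \<inter> U - {u}))"
      proof -
        have "a \<le> card (insert u (\<sigma> \<inter> U - {u}))"
          unfolding a_def using fin' by (intro card_mono) auto
        also have "\<dots> \<le> Suc (card (\<sigma> \<inter> U - {u}))"
        proof -
          have "card (insert u B) \<le> Suc (card B)" for B
            by (cases "finite B") (simp_all add: card_insert_if)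
          then show ?thesis .
        qed
        finally show ?thesis .
      qed
      ultimately show ?thesis by simp
    qed
    have le: "a' \<le> a" "b' \<le> b"
      unfolding a'_def a_def b'_def b_def using G fin' by (auto intro!: card_mono)

    \<comment> \<open>By now \<open>(a, b)\<close> is \<open>(k + e, k - 1)\<close>, or \<open>(k, k)\<close> with \<open>e = 1\<close>; a proper face has a
      smaller vertex number on one of the sides.\<close>
    have "a' + b' < a + b"
    proof -
      have "card F = card (F \<inter> U) + card (F \<inter> V)" if "F \<subseteq> U \<union> V" for F
      proof -
        have "F = (F \<inter> U) \<union> (F \<inter> V)" using that by blast
        then show ?thesis using card_Un_disjoint[OF fin'(1,2), of F F] disj by auto
      qed
      moreover have "card G < card \<sigma>" using G simplicial_complexD(1)[OF L \<sigma>] by (simp add: psubset_card_mono)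
      ultimately show ?thesis using sub G unfolding a'_def a_def b'_def b_def by (metis order_trans psubset_imp_subset)
    qed
    then have "a' < k \<or> Suc b' < k \<or> a' < k + e \<and> Suc b' < k + e"
      using le low in' out' e by linarith
    moreover have "v \<notin> G" "G \<subseteq> U \<union> V" using G v\<sigma> sub by auto
    ultimately have "insert v G \<in> ?K"
      using v ins[of G] by (auto simp: bounded_sides_def a'_def b'_def)
    then show "insert v G \<in> L" using star_C by (simp add: L_def)
  qed
  ultimately show ?thesis
    unfolding homotopy_wedge_of_spheres_def by (blast intro: homotopy_eqv_trans)
qed

theorem theorem4p3:
  fixes G :: "('a, 'b) pre_digraph" and m n t :: nat
  assumes "1 \<le> m" and "m \<le> n"
    and "complete_bipartite_digraph m n G"
    and "2 \<le> t" and "t \<le> longest_path_length G + 1"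
  shows "homotopy_wedge_of_spheres (geometric_realization (path_free_complex t G))"
proof -
  obtain U V where G: "graph G" "verts G = U \<union> V" "U \<inter> V = {}" "arcs_ends G = U \<times> V \<union> V \<times> U"
    and card: "card U = m" "card V = n"
    using assms(3) by (auto simp: complete_bipartite_digraph_def)
  interpret graph G by fact
  have fin: "finite U" "finite V" "finite (U \<union> V)" using finite_verts G(2) by auto
  define k where "k = t div 2"
  define e where "e = t mod 2"
  have t: "t = 2 * k + e" "e \<le> 1" by (auto simp: k_def e_def)
  have k: "1 \<le> k" using assms(4) t by simp
  have ne: "verts G \<noteq> {}" using card assms(1) G(2) by auto
  obtain f where "inj_on f {..<t}" "f ` {..<t} \<subseteq> verts G"
    "\<And>i. Suc i < t \<Longrightarrow> (f i, f (Suc i)) \<in> arcs_ends G"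
    using walk_of_length_le_longest_path[OF G(1) ne assms(5)] by metis
  then have "(t + 1) div 2 \<le> m \<and> t div 2 \<le> n \<or> t div 2 \<le> m \<and> (t + 1) div 2 \<le> n"
    using bipartite_walk_iff[OF fin(3) G(3), of t] card unfolding G(2,4)
    by (auto simp: Int_absorb1 Int_absorb2)
  then have "k \<le> m" "k + e \<le> n" using assms(2) t by auto
  then have "homotopy_wedge_of_spheres (geometric_realization (bounded_sides U V k e))"
    using fin G(3) k t(2) card by (intro wedge_of_spheres_bounded_sides) auto
  then show ?thesis using path_free_complex_bipartite[OF G t(2), of k] t(1) by simp
qed

end
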